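(* Assume that $$\sum_{k=0}^{\infty}\sum_{i=0}^{\infty}|w_k|\,\theta_{i,i-k}<\infty .$$ Then, as $n\to\infty$, $$\frac{1}{\sqrt n}\sum_{1\le i,j\le n}w_{i-j}Y_{i,j}\xrightarrow{d}\mathrm N(0,\sigma^2)$$ for some $\sigma^2<\infty$.
   Context: Let $(\varepsilon_i)_{i\in\mathbb Z}$ be i.i.d. random elements taking values in a general state space, and let $\mathbf Z_i=(\ldots,\varepsilon_{i-1},\varepsilon_i)$. Let $Y_{i,j}$, $i,j\in\mathbb Z$, be real random variables with zero means and finite variances such that $Y_{i,j}=Y_{j,i}$, $Y_{i,j}$ is $\sigma(\mathbf Z_{i\vee j})$-measurable (where $i\vee j=\max(i,j)$), and $(Y_{i,j},\mathbf Z_k)$ is a stationary process in the sense that, for each $t\in\mathbb Z$, $(Y_{i+t,j+t},\mathbf Z_{k+t})$, indexed by $(i,j,k)\in\mathbb Z^3$, has the same finite-dimensional distributions as $(Y_{i,j},\mathbf Z_k)$. The weights $(w_i)_{i\in\mathbb Z}$ are real constants with $w_{-i}=w_i$. For an integrable random variable $\xi$ put $\mathcal P_t\xi=E(\xi|\mathbf Z_t)-E(\xi|\mathbf Z_{t-1})$, $t\in\mathbb Z$; $\|\xi\|=(E\xi^2)^{1/2}$. Define $\theta_{i,j}=\|\mathcal P_0Y_{i,j}\|$. $\xrightarrow{d}$ denotes convergence in distribution and $\mathrm N(0,\sigma^2)$ is the normal law with mean $0$ and variance $\sigma^2$ (degenerate at $0$ if $\sigma^2=0$). *)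

theory Defs
  imports "HOL-Probability.Probability"
begin

text \<open>
  The past \<open>(\<dots>, \<epsilon>\<^sub>t\<^sub>-\<^sub>1, \<epsilon>\<^sub>t)\<close> is indexed by the lag \<open>l\<close>, so that it takes
  values in the same product space for every \<open>t\<close>; joint laws of pasts at
  different times can then be compared.
\<close>

definition past :: "(int \<Rightarrow> 'a \<Rightarrow> 's) \<Rightarrow> int \<Rightarrow> 'a \<Rightarrow> nat \<Rightarrow> 's" where
  "past \<epsilon> t \<omega> = (\<lambda>l. \<epsilon> (t - int l) \<omega>)"

definition past_space :: "'s measure \<Rightarrow> (nat \<Rightarrow> 's) measure" where
  "past_space S = PiM UNIV (\<lambda>_. S)"

definition past_algebra ::
    "'a measure \<Rightarrow> 's measure \<Rightarrow> (int \<Rightarrow> 'a \<Rightarrow> 's) \<Rightarrow> int \<Rightarrow> 'a measure" where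
  "past_algebra M S \<epsilon> t = vimage_algebra (space M) (past \<epsilon> t) (past_space S)"

definition iid ::
    "'a measure \<Rightarrow> 's measure \<Rightarrow> ('i \<Rightarrow> 'a \<Rightarrow> 's) \<Rightarrow> bool" where
  "iid M S \<epsilon> \<longleftrightarrow>
     prob_space.indep_vars M (\<lambda>_. S) \<epsilon> UNIV \<and>
     (\<forall>i j. distr M S (\<epsilon> i) = distr M S (\<epsilon> j))"

definition same_fdd ::
    "'a measure \<Rightarrow> 'b measure \<Rightarrow> ('i \<Rightarrow> 'a \<Rightarrow> 'b) \<Rightarrow> ('i \<Rightarrow> 'a \<Rightarrow> 'b) \<Rightarrow> bool" where
  "same_fdd M N X X' \<longleftrightarrow>
     (\<forall>J. finite J \<longrightarrow>
        distr M (PiM J (\<lambda>_. N)) (\<lambda>\<omega>. \<lambda>i\<in>J. X i \<omega>) =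
        distr M (PiM J (\<lambda>_. N)) (\<lambda>\<omega>. \<lambda>i\<in>J. X' i \<omega>))"

definition jointly_stationary ::
    "'a measure \<Rightarrow> 's measure \<Rightarrow> (int \<Rightarrow> 'a \<Rightarrow> 's) \<Rightarrow> (int \<Rightarrow> int \<Rightarrow> 'a \<Rightarrow> real) \<Rightarrow> bool" where
  "jointly_stationary M S \<epsilon> Y \<longleftrightarrow>
     (\<forall>t. same_fdd M (borel \<Otimes>\<^sub>M past_space S)
        (\<lambda>(i, j, k) \<omega>. (Y (i + t) (j + t) \<omega>, past \<epsilon> (k + t) \<omega>))
        (\<lambda>(i, j, k) \<omega>. (Y i j \<omega>, past \<epsilon> k \<omega>)))"

definition projection ::
    "'a measure \<Rightarrow> 's measure \<Rightarrow> (int \<Rightarrow> 'a \<Rightarrow> 's) \<Rightarrow> int \<Rightarrow> ('a \<Rightarrow> real) \<Rightarrow> 'a \<Rightarrow> real" where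
  "projection M S \<epsilon> t \<xi> \<omega> =
     real_cond_exp M (past_algebra M S \<epsilon> t) \<xi> \<omega> -
     real_cond_exp M (past_algebra M S \<epsilon> (t - 1)) \<xi> \<omega>"

definition l2_norm :: "'a measure \<Rightarrow> ('a \<Rightarrow> real) \<Rightarrow> real" where
  "l2_norm M \<xi> = sqrt (integral\<^sup>L M (\<lambda>\<omega>. (\<xi> \<omega>)\<^sup>2))"

definition theta ::
    "'a measure \<Rightarrow> 's measure \<Rightarrow> (int \<Rightarrow> 'a \<Rightarrow> 's) \<Rightarrow> (int \<Rightarrow> int \<Rightarrow> 'a \<Rightarrow> real) \<Rightarrow>
     int \<Rightarrow> int \<Rightarrow> real" where
  "theta M S \<epsilon> Y i j = l2_norm M (projection M S \<epsilon> 0 (Y i j))"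

definition normal_law :: "real \<Rightarrow> real \<Rightarrow> real measure" where
  "normal_law \<mu> v =
     (if v = 0 then return borel \<mu> else density lborel (normal_density \<mu> (sqrt v)))"

end

theory Submission
  imports Defs
begin

text \<open>
  Write \<open>X\<^sub>i\<^sub>j = w\<^sub>i\<^sub>-\<^sub>j Y\<^sub>i\<^sub>j\<close>, let \<open>F\<^sub>t\<close> be the algebra of the past at time \<open>t\<close>, and let \<open>S\<^sub>n\<close> be the sum
  of \<open>X\<^sub>i\<^sub>j\<close> over \<open>1 \<le> i, j \<le> n\<close>. The proof replaces \<open>S\<^sub>n\<close> by a sum of stationary martingale
  differences that are functions of the past.

  By stationarity, \<open>\<parallel>P\<^sub>t X\<^sub>i\<^sub>j\<parallel>\<close> is a function \<open>\<alpha>\<close> of \<open>(i - t, j - t)\<close>, and the hypothesis together with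
  the symmetry of \<open>Y\<close> and \<open>w\<close> says that \<open>\<alpha>\<close> is summable over the plane
  (\<open>summable_on_half_plane\<close>). Keep only the offsets in a window \<open>[-N, N]\<^sup>2\<close> and put
  \<open>D\<^sub>t = \<Sum> P\<^sub>t X\<^sub>t\<^sub>+\<^sub>a\<^sub>,\<^sub>t\<^sub>+\<^sub>b\<close>. The difference \<open>R = S\<^sub>n - (D\<^sub>1 + \<dots> + D\<^sub>n)\<close> is measured through its
  projections: \<open>\<parallel>R\<parallel>\<^sup>2 = \<Sum> \<parallel>P\<^sub>t R\<parallel>\<^sup>2\<close>, since projections at different times are orthogonal and,
  by a zero-one law, nothing is left at time \<open>-\<infinity>\<close> (\<open>second_moment_le_projections\<close>).
  Except for at most \<open>3 N\<close> times \<open>t\<close>, \<open>\<parallel>P\<^sub>t R\<parallel>\<close> is at most the tail of \<open>\<alpha>\<close> outside the window, and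
  the norms for all \<open>t \<le> 0\<close> have a sum of order \<open>n\<close>; so \<open>\<parallel>R\<parallel> / \<surd>n\<close> is small for large \<open>N\<close>, uniformly in large \<open>n\<close> (\<open>remainder_second_moment_le\<close>).

  For a fixed window the central limit theorem for \<open>D\<^sub>1 + \<dots> + D\<^sub>n\<close> follows from a recursion
  for the characteristic function (\<open>martingale_difference_clt\<close>). The linear term of the expansion
  of \<open>exp (i v D\<^sub>r\<^sub>+\<^sub>1)\<close> disappears by the martingale property. In the quadratic term \<open>D\<^sub>r\<^sub>+\<^sub>1\<^sup>2\<close> may be
  replaced by its mean, because a function of the innovations up to time \<open>t\<close> is asymptotically
  independent of the innovations up to \<open>t - m\<close> as \<open>m\<close> grows, uniformly in \<open>t\<close>
  (\<open>square_integrable_mixing\<close>). The same asymptotic independence yields the zero-one law.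

  Finally, if a sequence has for every \<open>e > 0\<close> an approximation within \<open>e\<close> in mean square that
  is asymptotically centred normal, then it is asymptotically centred normal itself
  (\<open>normal_limit_by_approximation\<close>).
\<close>

section \<open>Square-integrable functions\<close>

definition square_integrable :: "'a measure \<Rightarrow> ('a \<Rightarrow> real) \<Rightarrow> bool" where
  "square_integrable M X \<longleftrightarrow> X \<in> borel_measurable M \<and> integrable M (\<lambda>\<omega>. (X \<omega>)\<^sup>2)"

lemma square_integrable_measurable [measurable_dest]:
  "square_integrable M X \<Longrightarrow> X \<in> borel_measurable M"
  by (simp add: square_integrable_def)

lemma square_integrable_mult:
  assumes "square_integrable M X" "square_integrable M Y"
  shows "integrable M (\<lambda>\<omega>. X \<omega> * Y \<omega>)"
proof (rule Bochner_Integration.integrable_bound)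
  show "integrable M (\<lambda>\<omega>. (X \<omega>)\<^sup>2 + (Y \<omega>)\<^sup>2)"
    using assms by (simp add: square_integrable_def)
  show "AE \<omega> in M. norm (X \<omega> * Y \<omega>) \<le> norm ((X \<omega>)\<^sup>2 + (Y \<omega>)\<^sup>2)"
  proof (rule AE_I2)
    fix \<omega>
    have "2 * \<bar>X \<omega> * Y \<omega>\<bar> \<le> (X \<omega>)\<^sup>2 + (Y \<omega>)\<^sup>2"
      using sum_squares_bound[of "\<bar>X \<omega>\<bar>" "\<bar>Y \<omega>\<bar>"] by (simp add: abs_mult)
    then show "norm (X \<omega> * Y \<omega>) \<le> norm ((X \<omega>)\<^sup>2 + (Y \<omega>)\<^sup>2)" by simp
  qed
qed (use assms in \<open>auto simp: square_integrable_def\<close>)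

lemma square_integrable_add:
  assumes "square_integrable M X" "square_integrable M Y"
  shows "square_integrable M (\<lambda>\<omega>. X \<omega> + Y \<omega>)"
  using assms square_integrable_mult[OF assms]
  by (auto simp: square_integrable_def power2_sum mult.assoc)

lemma square_integrable_cmult:
  "square_integrable M X \<Longrightarrow> square_integrable M (\<lambda>\<omega>. c * X \<omega>)"
  by (auto simp: square_integrable_def power_mult_distrib)

lemma square_integrable_diff:
  assumes "square_integrable M X" "square_integrable M Y"
  shows "square_integrable M (\<lambda>\<omega>. X \<omega> - Y \<omega>)"
  using square_integrable_add[OF assms(1) square_integrable_cmult[OF assms(2), of "-1"]] by simp

lemma square_integrable_sum:
  "(\<And>i. i \<in> I \<Longrightarrow> square_integrable M (X i)) \<Longrightarrow> square_integrable M (\<lambda>\<omega>. \<Sum>i\<in>I. X i \<omega>)"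
  by (induction I rule: infinite_finite_induct)
     (auto simp: square_integrable_def[of _ "\<lambda>_. 0"] intro: square_integrable_add)

lemma square_integrable_cong_AE:
  assumes "square_integrable M X" "Y \<in> borel_measurable M" "AE \<omega> in M. X \<omega> = Y \<omega>"
  shows "square_integrable M Y"
proof -
  have [measurable]: "X \<in> borel_measurable M" "Y \<in> borel_measurable M"
    using assms by (auto simp: square_integrable_def)
  have "integrable M (\<lambda>\<omega>. (X \<omega>)\<^sup>2) = integrable M (\<lambda>\<omega>. (Y \<omega>)\<^sup>2)"
    using assms(3) by (intro integrable_cong_AE) auto
  then show ?thesis using assms by (auto simp: square_integrable_def)
qed

lemma (in prob_space) square_integrable_bounded:
  assumes "X \<in> borel_measurable M" "\<And>\<omega>. \<bar>X \<omega>\<bar> \<le> B"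
  shows "square_integrable M X"
  unfolding square_integrable_def
proof (intro conjI)
  show "integrable M (\<lambda>\<omega>. (X \<omega>)\<^sup>2)"
  proof (rule integrable_const_bound[where B="B\<^sup>2"])
    show "AE \<omega> in M. norm ((X \<omega>)\<^sup>2) \<le> B\<^sup>2"
      using power_mono[OF assms(2) abs_ge_zero, where n = 2] by (auto intro!: AE_I2)
  qed (use assms in auto)
qed (use assms in auto)

lemma (in prob_space) square_integrable_integrable:
  "square_integrable M X \<Longrightarrow> integrable M X"
  unfolding square_integrable_def by (auto intro: square_integrable_imp_integrable)

lemma l2_norm_nonneg [simp]: "0 \<le> l2_norm M X"
  by (simp add: l2_norm_def)

lemma l2_norm_square: "(l2_norm M X)\<^sup>2 = (\<integral>\<omega>. (X \<omega>)\<^sup>2 \<partial>M)"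
  by (simp add: l2_norm_def)

lemma l2_norm_cong_AE:
  assumes "X \<in> borel_measurable M" "Y \<in> borel_measurable M" "AE \<omega> in M. X \<omega> = Y \<omega>"
  shows "l2_norm M X = l2_norm M Y"
proof -
  have "(\<integral>\<omega>. (X \<omega>)\<^sup>2 \<partial>M) = (\<integral>\<omega>. (Y \<omega>)\<^sup>2 \<partial>M)"
    using assms by (intro integral_cong_AE) auto
  then show ?thesis by (simp add: l2_norm_def)
qed

lemma l2_norm_cmult: "l2_norm M (\<lambda>\<omega>. c * X \<omega>) = \<bar>c\<bar> * l2_norm M X"
  by (simp add: l2_norm_def power_mult_distrib real_sqrt_mult)

text \<open>
  For functions with norms \<open>a\<close> and \<open>b\<close>, integrate \<open>2 \<bar>x y\<bar> \<le> x\<^sup>2 b / a + y\<^sup>2 a / b\<close>; adding \<open>e > 0\<close> to both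
  norms and letting \<open>e \<rightarrow> 0\<close> covers a vanishing norm.
\<close>

lemma l2_cauchy_schwarz:
  assumes "square_integrable M X" "square_integrable M Y"
  shows "(\<integral>\<omega>. \<bar>X \<omega> * Y \<omega>\<bar> \<partial>M) \<le> l2_norm M X * l2_norm M Y"
proof -
  define I where "I = (\<integral>\<omega>. \<bar>X \<omega> * Y \<omega>\<bar> \<partial>M)"
  have *: "I \<le> (l2_norm M X + e) * (l2_norm M Y + e)" if "e > 0" for e
  proof -
    define a b where "a = l2_norm M X + e" and "b = l2_norm M Y + e"
    have ab: "0 < a" "0 < b" using that by (auto simp: a_def b_def add_nonneg_pos)
    have "2 * I = (\<integral>\<omega>. 2 * \<bar>X \<omega> * Y \<omega>\<bar> \<partial>M)" by (simp add: I_def)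
    also have "\<dots> \<le> (\<integral>\<omega>. (b / a) * (X \<omega>)\<^sup>2 + (a / b) * (Y \<omega>)\<^sup>2 \<partial>M)"
    proof (rule integral_mono)
      show "integrable M (\<lambda>\<omega>. 2 * \<bar>X \<omega> * Y \<omega>\<bar>)"
        using square_integrable_mult[OF assms] by (intro integrable_mult_right integrable_abs) simp
      show "integrable M (\<lambda>\<omega>. (b / a) * (X \<omega>)\<^sup>2 + (a / b) * (Y \<omega>)\<^sup>2)"
        using assms by (auto simp: square_integrable_def)
      fix \<omega>
      have "2 * \<bar>X \<omega> * Y \<omega>\<bar> = 2 * (sqrt (b / a) * \<bar>X \<omega>\<bar>) * (sqrt (a / b) * \<bar>Y \<omega>\<bar>)"
        using ab by (simp add: abs_mult real_sqrt_divide)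
      also have "\<dots> \<le> (sqrt (b / a) * \<bar>X \<omega>\<bar>)\<^sup>2 + (sqrt (a / b) * \<bar>Y \<omega>\<bar>)\<^sup>2"
        by (rule sum_squares_bound)
      also have "\<dots> = (b / a) * (X \<omega>)\<^sup>2 + (a / b) * (Y \<omega>)\<^sup>2"
        using ab by (simp add: power_mult_distrib)
      finally show "2 * \<bar>X \<omega> * Y \<omega>\<bar> \<le> (b / a) * (X \<omega>)\<^sup>2 + (a / b) * (Y \<omega>)\<^sup>2" .
    qed
    also have "\<dots> = (b / a) * (l2_norm M X)\<^sup>2 + (a / b) * (l2_norm M Y)\<^sup>2"
      using assms by (simp add: square_integrable_def l2_norm_square)
    also have "\<dots> \<le> (b / a) * a\<^sup>2 + (a / b) * b\<^sup>2"
      using ab that by (intro add_mono mult_left_mono power_mono) (auto simp: a_def b_def)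
    also have "\<dots> = 2 * (a * b)" using ab by (simp add: power2_eq_square)
    finally show ?thesis by (simp add: a_def b_def)
  qed
  have "((\<lambda>e. (l2_norm M X + e) * (l2_norm M Y + e)) \<longlongrightarrow>
      (l2_norm M X + 0) * (l2_norm M Y + 0)) (at_right 0)"
    by (intro tendsto_intros)
  moreover have "eventually (\<lambda>e. I \<le> (l2_norm M X + e) * (l2_norm M Y + e)) (at_right 0)"
    using * by (auto simp: eventually_at_right_field intro: exI[of _ 1])
  ultimately have "I \<le> (l2_norm M X + 0) * (l2_norm M Y + 0)"
    by (rule tendsto_lowerbound) simp
  then show ?thesis by (simp add: I_def)
qed

lemma l2_cauchy_schwarz_abs:
  assumes "square_integrable M X" "square_integrable M Y"
  shows "\<bar>\<integral>\<omega>. X \<omega> * Y \<omega> \<partial>M\<bar> \<le> l2_norm M X * l2_norm M Y"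
  using integral_abs_bound[of M "\<lambda>\<omega>. X \<omega> * Y \<omega>"] l2_cauchy_schwarz[OF assms] by linarith

lemma l2_norm_add:
  assumes "square_integrable M X" "square_integrable M Y"
  shows "l2_norm M (\<lambda>\<omega>. X \<omega> + Y \<omega>) \<le> l2_norm M X + l2_norm M Y"
proof (rule power2_le_imp_le)
  have "(l2_norm M (\<lambda>\<omega>. X \<omega> + Y \<omega>))\<^sup>2
      = (\<integral>\<omega>. (X \<omega>)\<^sup>2 + (Y \<omega>)\<^sup>2 + 2 * (X \<omega> * Y \<omega>) \<partial>M)"
    by (simp add: l2_norm_square power2_sum mult.assoc)
  also have "\<dots> = (l2_norm M X)\<^sup>2 + (l2_norm M Y)\<^sup>2 + 2 * (\<integral>\<omega>. X \<omega> * Y \<omega> \<partial>M)"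
    using assms square_integrable_mult[OF assms] by (simp add: square_integrable_def l2_norm_square)
  also have "\<dots> \<le> (l2_norm M X)\<^sup>2 + (l2_norm M Y)\<^sup>2 + 2 * (l2_norm M X * l2_norm M Y)"
    using l2_cauchy_schwarz_abs[OF assms] by simp
  also have "\<dots> = (l2_norm M X + l2_norm M Y)\<^sup>2" by (simp add: power2_sum)
  finally show "(l2_norm M (\<lambda>\<omega>. X \<omega> + Y \<omega>))\<^sup>2 \<le> (l2_norm M X + l2_norm M Y)\<^sup>2" .
qed simp

lemma l2_norm_diff:
  assumes "square_integrable M X" "square_integrable M Y"
  shows "l2_norm M (\<lambda>\<omega>. X \<omega> - Y \<omega>) \<le> l2_norm M X + l2_norm M Y"
  using l2_norm_add[OF assms(1) square_integrable_cmult[OF assms(2), of "-1"]]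
    l2_norm_cmult[of M "-1" Y] by simp

lemma l2_norm_sum:
  assumes "\<And>i. i \<in> I \<Longrightarrow> square_integrable M (X i)"
  shows "l2_norm M (\<lambda>\<omega>. \<Sum>i\<in>I. X i \<omega>) \<le> (\<Sum>i\<in>I. l2_norm M (X i))"
  using assms
proof (induction I rule: infinite_finite_induct)
  case (insert i I)
  have "l2_norm M (\<lambda>\<omega>. X i \<omega> + (\<Sum>j\<in>I. X j \<omega>)) \<le> l2_norm M (X i) + l2_norm M (\<lambda>\<omega>. \<Sum>j\<in>I. X j \<omega>)"
    using insert.prems by (intro l2_norm_add square_integrable_sum) auto
  with insert show ?case by fastforce
qed (auto simp: l2_norm_def)

lemma (in prob_space) l2_norm_const: "l2_norm M (\<lambda>_. c) = \<bar>c\<bar>"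
  by (simp add: l2_norm_def prob_space)

lemma (in prob_space) l1_le_l2_norm:
  assumes "square_integrable M X"
  shows "(\<integral>\<omega>. \<bar>X \<omega>\<bar> \<partial>M) \<le> l2_norm M X"
proof -
  have "square_integrable M (\<lambda>_. 1)" by (rule square_integrable_bounded[of _ 1]) auto
  from l2_cauchy_schwarz[OF assms this] show ?thesis by (simp add: l2_norm_const)
qed

section \<open>Factorization of measurable functions\<close>

text \<open>
  A function measurable with respect to the preimage algebra of \<open>f\<close> factors through \<open>f\<close>: its
  sublevel sets at rational levels are preimages, and these sets determine it by an infimum.
\<close>

lemma vimage_algebra_factor:
  fixes h :: "'a \<Rightarrow> real"
  assumes f: "f \<in> \<Omega> \<rightarrow> space N" and h: "h \<in> borel_measurable (vimage_algebra \<Omega> f N)"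
  obtains g where "g \<in> borel_measurable N" "\<And>x. x \<in> \<Omega> \<Longrightarrow> h x = g (f x)"
proof -
  have "\<exists>A\<in>sets N. {x\<in>\<Omega>. h x < real_of_rat q} = f -` A \<inter> \<Omega>" for q
  proof -
    have "{x\<in>space (vimage_algebra \<Omega> f N). h x < real_of_rat q} \<in> sets (vimage_algebra \<Omega> f N)"
      using h by measurable
    then show ?thesis using f by (auto simp: sets_vimage_algebra2)
  qed
  then obtain A where A: "\<And>q. A q \<in> sets N" "\<And>q. {x\<in>\<Omega>. h x < real_of_rat q} = f -` A q \<inter> \<Omega>"
    by metis
  define G where "G y = (INF q. if y \<in> A q then ereal (real_of_rat q) else \<infinity>)" for y
  have [measurable]: "\<And>q. A q \<in> sets N" by (rule A)
  have "G \<in> borel_measurable N" unfolding G_def by measurable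
  moreover have "h x = real_of_ereal (G (f x))" if "x \<in> \<Omega>" for x
  proof -
    have m: "f x \<in> A q \<longleftrightarrow> h x < real_of_rat q" for q using A(2)[of q] that by auto
    have "G (f x) = ereal (h x)" unfolding G_def m
    proof (rule antisym)
      show "ereal (h x) \<le> (INF q. if h x < real_of_rat q then ereal (real_of_rat q) else \<infinity>)"
        by (rule INF_greatest) auto
      show "(INF q. if h x < real_of_rat q then ereal (real_of_rat q) else \<infinity>) \<le> ereal (h x)"
      proof (rule ereal_le_epsilon2)
        fix e :: real assume "0 < e"
        then obtain q where q: "h x < real_of_rat q" "real_of_rat q < h x + e"
          using of_rat_dense[of "h x" "h x + e"] by auto
        have "(INF q. if h x < real_of_rat q then ereal (real_of_rat q) else \<infinity>)
            \<le> (if h x < real_of_rat q then ereal (real_of_rat q) else \<infinity>)"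
          by (rule INF_lower) simp
        also have "\<dots> \<le> ereal (h x) + ereal e" using q by simp
        finally show "(INF q. if h x < real_of_rat q then ereal (real_of_rat q) else \<infinity>)
            \<le> ereal (h x) + ereal e" .
      qed
    qed
    then show ?thesis by simp
  qed
  ultimately show ?thesis using that[of "\<lambda>y. real_of_ereal (G y)"] by auto
qed

section \<open>Normal limits by approximation\<close>

lemma real_distribution_normal_law:
  assumes "0 \<le> v"
  shows "real_distribution (normal_law 0 v)"
proof (cases "v = 0")
  case True
  then show ?thesis
    by (auto simp: normal_law_def real_distribution_def real_distribution_axioms_def
        intro!: prob_space_return)
next
  case False
  with assms have "prob_space (density lborel (normal_density 0 (sqrt v)))"
    by (intro prob_space_normal_density) simp
  with False show ?thesis
    by (simp add: normal_law_def real_distribution_def real_distribution_axioms_def)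
qed

lemma char_normal_law:
  assumes "0 \<le> v"
  shows "char (normal_law 0 v) u = exp (- (v * u\<^sup>2 / 2))"
proof (cases "v = 0")
  case True
  then show ?thesis by (simp add: normal_law_def char_def integral_return)
next
  case False
  with assms have v: "0 < v" by simp
  interpret N: prob_space std_normal_distribution
    by (rule prob_space_normal_density) simp
  have "distributed std_normal_distribution lborel (\<lambda>x. x) std_normal_density"
    by (simp add: distributed_def distr_id2)
  from N.normal_density_affine[OF this, of "sqrt v" 0]
  have "distributed std_normal_distribution lborel (\<lambda>x. sqrt v * x) (normal_density 0 (sqrt v))"
    using v by simp
  then have "density lborel (normal_density 0 (sqrt v)) = distr std_normal_distribution lborel (\<lambda>x. sqrt v * x)"
    by (simp add: distributed_def)
  then have "normal_law 0 v = distr std_normal_distribution lborel (\<lambda>x. sqrt v * x)"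
    using v by (simp add: normal_law_def)
  then have "char (normal_law 0 v) u = (CLINT x|std_normal_distribution. iexp (u * (sqrt v * x)))"
    by (simp add: char_def integral_distr)
  also have "\<dots> = char std_normal_distribution (u * sqrt v)"
    by (simp add: char_def mult.assoc)
  also have "\<dots> = exp (- (v * u\<^sup>2 / 2))"
    using v by (simp add: char_std_normal_distribution power_mult_distrib mult.commute)
  finally show ?thesis .
qed

lemma norm_iexp_diff_le: "cmod (iexp x - iexp y) \<le> \<bar>x - y\<bar>"
proof -
  have "iexp x - iexp y = iexp y * (iexp (x - y) - 1)"
    by (simp add: algebra_simps flip: exp_add)
  then have "cmod (iexp x - iexp y) = cmod (iexp (x - y) - 1)"
    by (simp add: norm_mult)
  also have "\<dots> \<le> \<bar>x - y\<bar>" using iexp_approx1[of "x - y" 0] by simp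
  finally show ?thesis .
qed

lemma (in prob_space) integrable_iexp_comp:
  "X \<in> borel_measurable M \<Longrightarrow> integrable M (\<lambda>\<omega>. iexp (X \<omega>))"
  by (intro integrable_const_bound[where B=1]) auto

lemma char_distr:
  "X \<in> borel_measurable M \<Longrightarrow> char (distr M borel X) u = (CLINT \<omega>|M. iexp (u * X \<omega>))"
  by (simp add: char_def integral_distr)

lemma (in prob_space) char_distr_diff_le:
  assumes "square_integrable M X" "square_integrable M Y"
  shows "cmod (char (distr M borel X) u - char (distr M borel Y) u)
    \<le> \<bar>u\<bar> * l2_norm M (\<lambda>\<omega>. X \<omega> - Y \<omega>)"
proof -
  have [measurable]: "X \<in> borel_measurable M" "Y \<in> borel_measurable M"
    using assms by (auto simp: square_integrable_def)
  have d: "square_integrable M (\<lambda>\<omega>. X \<omega> - Y \<omega>)" by (rule square_integrable_diff[OF assms])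
  have "char (distr M borel X) u - char (distr M borel Y) u
      = (CLINT \<omega>|M. iexp (u * X \<omega>) - iexp (u * Y \<omega>))"
    unfolding char_distr[OF \<open>X \<in> borel_measurable M\<close>] char_distr[OF \<open>Y \<in> borel_measurable M\<close>]
    by (rule Bochner_Integration.integral_diff[symmetric]; rule integrable_iexp_comp; measurable)
  also have "cmod \<dots> \<le> (\<integral>\<omega>. cmod (iexp (u * X \<omega>) - iexp (u * Y \<omega>)) \<partial>M)"
    by (rule integral_norm_bound)
  also have "\<dots> \<le> (\<integral>\<omega>. \<bar>u\<bar> * \<bar>X \<omega> - Y \<omega>\<bar> \<partial>M)"
  proof (rule integral_mono)
    fix \<omega>
    show "cmod (iexp (u * X \<omega>) - iexp (u * Y \<omega>)) \<le> \<bar>u\<bar> * \<bar>X \<omega> - Y \<omega>\<bar>"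
      using norm_iexp_diff_le[of "u * X \<omega>" "u * Y \<omega>"]
      by (simp add: abs_mult flip: right_diff_distrib)
    show "integrable M (\<lambda>\<omega>. cmod (iexp (u * X \<omega>) - iexp (u * Y \<omega>)))"
      by (intro integrable_norm Bochner_Integration.integrable_diff; rule integrable_iexp_comp; measurable)
  qed (use square_integrable_integrable[OF d] in simp)
  also have "\<dots> \<le> \<bar>u\<bar> * l2_norm M (\<lambda>\<omega>. X \<omega> - Y \<omega>)"
    using l1_le_l2_norm[OF d] by (simp add: mult_left_mono)
  finally show ?thesis .
qed

text \<open>
  The characteristic functions of two approximations with variances \<open>v\<close>, \<open>v'\<close> and errors
  \<open>e\<close>, \<open>e'\<close> differ by at most \<open>\<bar>u\<bar> (e + e')\<close> in the limit. For a small fixed \<open>u\<close> this keeps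
  the variances bounded: otherwise one of the two functions would be near \<open>0\<close> where the
  other is near \<open>1\<close>. A cluster point of the variances as \<open>e \<rightarrow> 0\<close> is then the variance of the
  limit.
\<close>

lemma (in prob_space) normal_limit_by_approximation:
  fixes S :: "nat \<Rightarrow> 'a \<Rightarrow> real"
  assumes S: "\<And>n. square_integrable M (S n)"
    and approx: "\<And>e. 0 < e \<Longrightarrow> \<exists>T v. 0 \<le> v \<and> (\<forall>n. square_integrable M (T n)) \<and>
      (\<forall>\<^sub>F n in sequentially. l2_norm M (\<lambda>\<omega>. S n \<omega> - T n \<omega>) \<le> e) \<and>
      (\<forall>u. (\<lambda>n. char (distr M borel (T n)) u) \<longlonglongrightarrow> exp (- (v * u\<^sup>2 / 2)))"
  shows "\<exists>v\<ge>0. weak_conv_m (\<lambda>n. distr M borel (S n)) (normal_law 0 v)"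
proof -
  define e where "e k = 1 / real (Suc k)" for k
  have e_pos: "0 < e k" for k by (simp add: e_def)
  define good where "good k T v \<longleftrightarrow> 0 \<le> v \<and> (\<forall>n. square_integrable M (T n)) \<and>
      (\<forall>\<^sub>F n in sequentially. l2_norm M (\<lambda>\<omega>. S n \<omega> - T n \<omega>) \<le> e k) \<and>
      (\<forall>u. (\<lambda>n. char (distr M borel (T n)) u) \<longlonglongrightarrow> exp (- (v * u\<^sup>2 / 2)))" for k T v
  have "\<forall>k. \<exists>T v. good k T v" unfolding good_def using approx[OF e_pos] by blast
  then obtain T v where "\<And>k. good k (T k) (v k)" by metis
  then have v0: "\<And>k. 0 \<le> v k" and T: "\<And>k n. square_integrable M (T k n)"
    and ST: "\<And>k. \<forall>\<^sub>F n in sequentially. l2_norm M (\<lambda>\<omega>. S n \<omega> - T k n \<omega>) \<le> e k"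
    and Tv: "\<And>k u. (\<lambda>n. char (distr M borel (T k n)) u) \<longlonglongrightarrow> exp (- (v k * u\<^sup>2 / 2))"
    unfolding good_def by blast+
  define \<phi> where "\<phi> n u = char (distr M borel (S n)) u" for n u
  have near: "\<forall>\<^sub>F n in sequentially. cmod (\<phi> n u - exp (- (v k * u\<^sup>2 / 2))) \<le> \<bar>u\<bar> * e k + d"
    if "0 < d" for u k d
    using ST[of k] tendstoD[OF Tv[of k u] that]
  proof eventually_elim
    case (elim n)
    have "cmod (\<phi> n u - char (distr M borel (T k n)) u) \<le> \<bar>u\<bar> * l2_norm M (\<lambda>\<omega>. S n \<omega> - T k n \<omega>)"
      unfolding \<phi>_def by (rule char_distr_diff_le[OF S T])
    also have "\<dots> \<le> \<bar>u\<bar> * e k" using elim by (intro mult_left_mono) auto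
    finally show ?case using elim(2)
      norm_triangle_ineq[of "\<phi> n u - char (distr M borel (T k n)) u"
        "char (distr M borel (T k n)) u - exp (- (v k * u\<^sup>2 / 2))"]
      by (simp add: dist_norm)
  qed
  have close: "exp (- (v 0 * u\<^sup>2 / 2)) \<le> exp (- (v k * u\<^sup>2 / 2)) + \<bar>u\<bar> * (e 0 + e k)" for u k
  proof (rule field_le_epsilon)
    fix d :: real assume d: "0 < d"
    have "\<forall>\<^sub>F n in sequentially. cmod (\<phi> n u - exp (- (v 0 * u\<^sup>2 / 2))) \<le> \<bar>u\<bar> * e 0 + d / 2 \<and>
        cmod (\<phi> n u - exp (- (v k * u\<^sup>2 / 2))) \<le> \<bar>u\<bar> * e k + d / 2"
      using d by (intro eventually_conj near) auto
    then obtain n where n: "cmod (\<phi> n u - exp (- (v 0 * u\<^sup>2 / 2))) \<le> \<bar>u\<bar> * e 0 + d / 2"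
      "cmod (\<phi> n u - exp (- (v k * u\<^sup>2 / 2))) \<le> \<bar>u\<bar> * e k + d / 2"
      by (auto simp: eventually_sequentially)
    have "cmod (complex_of_real (exp (- (v 0 * u\<^sup>2 / 2))) - exp (- (v k * u\<^sup>2 / 2))) \<le> \<bar>u\<bar> * (e 0 + e k) + d"
      using norm_triangle_ineq4[of "\<phi> n u - exp (- (v k * u\<^sup>2 / 2))" "\<phi> n u - exp (- (v 0 * u\<^sup>2 / 2))"] n
      by (simp add: algebra_simps)
    then have "\<bar>exp (- (v 0 * u\<^sup>2 / 2)) - exp (- (v k * u\<^sup>2 / 2))\<bar> \<le> \<bar>u\<bar> * (e 0 + e k) + d"
      by (metis norm_of_real of_real_diff)
    then show "exp (- (v 0 * u\<^sup>2 / 2)) \<le> exp (- (v k * u\<^sup>2 / 2)) + \<bar>u\<bar> * (e 0 + e k) + d" by linarith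
  qed
  \<comment> \<open>At a small frequency \<open>u0\<close> the first approximation keeps every other one away from \<open>0\<close>;
    the factor \<open>2\<close> bounds \<open>e 0 + e k\<close>.\<close>
  have "((\<lambda>u. exp (- (v 0 * u\<^sup>2 / 2)) - \<bar>u\<bar> * 2) \<longlongrightarrow> exp (- (v 0 * 0\<^sup>2 / 2)) - \<bar>0\<bar> * 2) (at_right 0)"
    by (intro tendsto_intros) auto
  then have "\<forall>\<^sub>F u in at_right (0::real). 1 / 2 < exp (- (v 0 * u\<^sup>2 / 2)) - \<bar>u\<bar> * 2"
    by (intro order_tendstoD(1)) auto
  moreover have "\<forall>\<^sub>F u in at_right (0::real). 0 < u"
    by (rule eventually_at_right_less)
  ultimately have "\<forall>\<^sub>F u in at_right (0::real). 1 / 2 < exp (- (v 0 * u\<^sup>2 / 2)) - \<bar>u\<bar> * 2 \<and> 0 < u"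
    by (rule eventually_conj)
  from eventually_happens'[OF trivial_limit_at_right_real this]
  obtain u0 :: real where u0': "1 / 2 < exp (- (v 0 * u0\<^sup>2 / 2)) - \<bar>u0\<bar> * 2 \<and> 0 < u0" ..
  then have u0: "0 < u0" "1 / 2 < exp (- (v 0 * u0\<^sup>2 / 2)) - u0 * 2" by auto
  have bound: "v k \<le> 2 * ln 2 / u0\<^sup>2" for k
  proof -
    have "u0 * (e 0 + e k) \<le> u0 * 2" using u0 by (intro mult_left_mono) (auto simp: e_def field_simps)
    then have "1 / 2 < exp (- (v k * u0\<^sup>2 / 2))" using close[of u0 k, unfolded abs_of_pos[OF u0(1)]] u0(2) by linarith
    then have "ln (1 / 2) < - (v k * u0\<^sup>2 / 2)" using ln_less_cancel_iff[of "1 / 2" "exp (- (v k * u0\<^sup>2 / 2))"] by simp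
    then show ?thesis using u0 by (simp add: ln_div field_simps)
  qed
  have "bounded (range v)"
    using v0 bound by (intro boundedI[where B="2 * ln 2 / u0\<^sup>2"]) auto
  from bounded_imp_convergent_subsequence[OF this] obtain l r where
    r: "strict_mono r" and l: "(v \<circ> r) \<longlonglongrightarrow> l" by blast
  have l0: "0 \<le> l" using l v0 by (intro LIMSEQ_le_const[OF l]) auto
  have e_lim: "(\<lambda>k. e (r k)) \<longlonglongrightarrow> 0"
  proof -
    have "e \<longlonglongrightarrow> 0" unfolding e_def by (rule LIMSEQ_Suc[OF lim_1_over_n])
    then show ?thesis using LIMSEQ_subseq_LIMSEQ[OF _ r] by (simp add: comp_def)
  qed
  have "(\<lambda>n. \<phi> n u) \<longlonglongrightarrow> exp (- (l * u\<^sup>2 / 2))" for u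
  proof (rule tendstoI)
    fix d :: real assume d: "0 < d"
    have "(\<lambda>k. exp (- (v (r k) * u\<^sup>2 / 2))) \<longlonglongrightarrow> exp (- (l * u\<^sup>2 / 2))"
      using l unfolding comp_def by (intro tendsto_intros) auto
    from tendstoD[OF this, of "d / 3"] d
    have "\<forall>\<^sub>F k in sequentially. dist (exp (- (v (r k) * u\<^sup>2 / 2))) (exp (- (l * u\<^sup>2 / 2))) < d / 3"
      by simp
    moreover have "(\<lambda>k. \<bar>u\<bar> * e (r k)) \<longlonglongrightarrow> \<bar>u\<bar> * 0" by (intro tendsto_intros e_lim)
    then have "\<forall>\<^sub>F k in sequentially. \<bar>u\<bar> * e (r k) < d / 3"
      using d by (intro order_tendstoD(2)) auto
    ultimately have "\<forall>\<^sub>F k in sequentially. dist (exp (- (v (r k) * u\<^sup>2 / 2))) (exp (- (l * u\<^sup>2 / 2))) < d / 3 \<and>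
        \<bar>u\<bar> * e (r k) < d / 3" by (rule eventually_conj)
    then obtain k where k: "\<bar>exp (- (v (r k) * u\<^sup>2 / 2)) - exp (- (l * u\<^sup>2 / 2))\<bar> < d / 3" "\<bar>u\<bar> * e (r k) < d / 3"
      by (auto simp: eventually_sequentially dist_real_def)
    have k': "cmod (complex_of_real (exp (- (v (r k) * u\<^sup>2 / 2))) - exp (- (l * u\<^sup>2 / 2))) < d / 3"
      using k(1) by (metis norm_of_real of_real_diff)
    show "\<forall>\<^sub>F n in sequentially. dist (\<phi> n u) (exp (- (l * u\<^sup>2 / 2))) < d"
      using near[of "d / 3" u "r k", OF divide_pos_pos[OF d zero_less_numeral]]
    proof eventually_elim
      case (elim n)
      then show ?case using k(2) k'
          norm_triangle_ineq[of "\<phi> n u - exp (- (v (r k) * u\<^sup>2 / 2))" "complex_of_real (exp (- (v (r k) * u\<^sup>2 / 2))) - exp (- (l * u\<^sup>2 / 2))"]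
        by (simp add: dist_norm)
    qed
  qed
  then have "weak_conv_m (\<lambda>n. distr M borel (S n)) (normal_law 0 l)"
    using l0 S unfolding \<phi>_def
    by (intro levy_continuity real_distribution_normal_law real_distribution_distr)
       (auto simp: char_normal_law square_integrable_def)
  with l0 show ?thesis by blast
qed

section \<open>Pasts, conditional expectations and martingale differences\<close>

text \<open>
  The second assumption lets functions of pasts at different times be compared in law.
\<close>

locale past_process = prob_space M for M :: "'a measure" +
  fixes S :: "'s measure" and \<epsilon> :: "int \<Rightarrow> 'a \<Rightarrow> 's"
  assumes indep: "indep_vars (\<lambda>_. S) \<epsilon> UNIV"
    and past_law: "distr M (past_space S) (past \<epsilon> t) = distr M (past_space S) (past \<epsilon> 0)"
begin

abbreviation F :: "int \<Rightarrow> 'a measure" where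
  "F t \<equiv> past_algebra M S \<epsilon> t"

abbreviation E :: "int \<Rightarrow> ('a \<Rightarrow> real) \<Rightarrow> 'a \<Rightarrow> real" where
  "E t X \<equiv> real_cond_exp M (F t) X"

abbreviation P :: "int \<Rightarrow> ('a \<Rightarrow> real) \<Rightarrow> 'a \<Rightarrow> real" where
  "P t X \<equiv> projection M S \<epsilon> t X"

lemma innovation_measurable [measurable]: "\<epsilon> i \<in> M \<rightarrow>\<^sub>M S"
  using indep by (simp add: indep_vars_def)

lemma past_measurable [measurable]: "past \<epsilon> t \<in> M \<rightarrow>\<^sub>M past_space S"
  unfolding past_def past_space_def
  by (rule measurable_PiM_single') (auto intro!: measurable_space[OF innovation_measurable])

lemma past_in_space: "past \<epsilon> t \<in> space M \<rightarrow> space (past_space S)"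
  using measurable_space[OF past_measurable] by auto

lemma space_F [simp]: "space (F t) = space M"
  by (simp add: past_algebra_def)

lemma past_measurable_F: "past \<epsilon> t \<in> F t \<rightarrow>\<^sub>M past_space S"
  unfolding past_algebra_def by (rule measurable_vimage_algebra1[OF past_in_space])

lemma sets_F: "sets (F t) = {past \<epsilon> t -` A \<inter> space M | A. A \<in> sets (past_space S)}"
  unfolding past_algebra_def by (rule sets_vimage_algebra2[OF past_in_space])

definition shift :: "nat \<Rightarrow> (nat \<Rightarrow> 's) \<Rightarrow> nat \<Rightarrow> 's" where
  "shift m x = (\<lambda>l. x (l + m))"

lemma shift_measurable [measurable]: "shift m \<in> past_space S \<rightarrow>\<^sub>M past_space S"
  unfolding shift_def past_space_def
  by (rule measurable_PiM_single') (auto simp: space_PiM)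

lemma past_eq_shift: "s \<le> t \<Longrightarrow> past \<epsilon> s \<omega> = shift (nat (t - s)) (past \<epsilon> t \<omega>)"
  by (simp add: past_def shift_def algebra_simps)

lemma past_measurable_F_le: "s \<le> t \<Longrightarrow> past \<epsilon> s \<in> F t \<rightarrow>\<^sub>M past_space S"
  using measurable_compose[OF past_measurable_F[of t] shift_measurable[of "nat (t - s)"]]
  by (simp add: past_eq_shift[of s t, symmetric])

lemma subalgebra_M_F: "subalgebra M (F t)"
  unfolding subalgebra_def by (auto simp: sets_F)

lemma subalgebra_F_F: "s \<le> t \<Longrightarrow> subalgebra (F t) (F s)"
  unfolding subalgebra_def using measurable_sets[OF past_measurable_F_le[of s t]]
  by (auto simp: sets_F[of s])

lemma measurable_F_mono: "X \<in> borel_measurable (F s) \<Longrightarrow> s \<le> t \<Longrightarrow> X \<in> borel_measurable (F t)"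
  by (rule measurable_from_subalg[OF subalgebra_F_F])

lemma measurable_F_past:
  "g \<in> borel_measurable (past_space S) \<Longrightarrow> s \<le> t \<Longrightarrow> (\<lambda>\<omega>. g (past \<epsilon> s \<omega>)) \<in> borel_measurable (F t)"
  by (rule measurable_compose[OF past_measurable_F_le])

lemma measurable_F_factor:
  fixes X :: "'a \<Rightarrow> real"
  assumes "X \<in> borel_measurable (F t)"
  obtains g where "g \<in> borel_measurable (past_space S)" "\<And>\<omega>. \<omega> \<in> space M \<Longrightarrow> X \<omega> = g (past \<epsilon> t \<omega>)"
  by (rule vimage_algebra_factor[OF past_in_space assms[unfolded past_algebra_def]]) (rule that)

text \<open>
  These transfers let a function of the past be treated at time \<open>0\<close> only, which is what makes
  later estimates uniform in time.
\<close>

lemma past_law_integral: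
  fixes g :: "(nat \<Rightarrow> 's) \<Rightarrow> real"
  assumes [measurable]: "g \<in> borel_measurable (past_space S)"
  shows "(\<integral>\<omega>. g (past \<epsilon> s \<omega>) \<partial>M) = (\<integral>\<omega>. g (past \<epsilon> t \<omega>) \<partial>M)"
    and "integrable M (\<lambda>\<omega>. g (past \<epsilon> s \<omega>)) \<longleftrightarrow> integrable M (\<lambda>\<omega>. g (past \<epsilon> t \<omega>))"
  using past_law[of s] past_law[of t]
    integral_distr[OF past_measurable[of s] assms] integral_distr[OF past_measurable[of t] assms]
    integrable_distr_eq[OF past_measurable[of s] assms] integrable_distr_eq[OF past_measurable[of t] assms]
  by simp_all

lemma past_law_square_integrable:
  assumes [measurable]: "g \<in> borel_measurable (past_space S)"
  shows "square_integrable M (\<lambda>\<omega>. g (past \<epsilon> s \<omega>)) \<longleftrightarrow> square_integrable M (\<lambda>\<omega>. g (past \<epsilon> t \<omega>))"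
    and "l2_norm M (\<lambda>\<omega>. g (past \<epsilon> s \<omega>)) = l2_norm M (\<lambda>\<omega>. g (past \<epsilon> t \<omega>))"
  using past_law_integral[of "\<lambda>x. (g x)\<^sup>2" s t]
  by (auto simp: square_integrable_def l2_norm_def)

sublocale cond: finite_measure_subalgebra M "F t" for t
  by unfold_locales (rule subalgebra_M_F)

text \<open>
  As rewrite rules these facts would turn themselves into \<^const>\<open>True\<close> when they are supplied
  as facts, and would so be lost.
\<close>

declare cond.real_cond_exp_F_meas [simp del] cond.real_cond_exp_cmult [simp del]
  cond.real_cond_exp_diff [simp del] cond.real_cond_exp_sum [simp del]
  cond.real_cond_exp_nested_subalg [simp del]

lemma E_measurable_F: "s \<le> t \<Longrightarrow> E s X \<in> borel_measurable (F t)"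
  by (rule measurable_F_mono[OF borel_measurable_cond_exp])

lemma square_integrable_E:
  assumes "square_integrable M X"
  shows "square_integrable M (E t X)"
proof -
  have "integrable M (\<lambda>\<omega>. (E t X \<omega>)\<^sup>2)"
    using assms square_integrable_integrable[OF assms] convex_power2
    by (intro cond.integrable_convex_cond_exp[of X UNIV]) (auto simp: square_integrable_def)
  then show ?thesis by (simp add: square_integrable_def)
qed

lemma square_integrable_P: "square_integrable M X \<Longrightarrow> square_integrable M (P t X)"
  unfolding projection_def[abs_def] by (intro square_integrable_diff square_integrable_E)

lemma E_E:
  assumes "s \<le> t" "square_integrable M X"
  shows "AE \<omega> in M. E s (E t X) \<omega> = E s X \<omega>"
  using assms by (intro cond.real_cond_exp_nested_subalg subalgebra_M_F subalgebra_F_F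
      square_integrable_integrable)

lemma E_eq_self:
  assumes "X \<in> borel_measurable (F t)" "square_integrable M X"
  shows "AE \<omega> in M. E t X \<omega> = X \<omega>"
  using assms by (intro cond.real_cond_exp_F_meas square_integrable_integrable)

lemma integral_mult_E:
  assumes "V \<in> borel_measurable (F t)" "square_integrable M V" "square_integrable M X"
  shows "(\<integral>\<omega>. V \<omega> * E t X \<omega> \<partial>M) = (\<integral>\<omega>. V \<omega> * X \<omega> \<partial>M)"
  using assms by (intro cond.real_cond_exp_intg square_integrable_mult) auto

text \<open>
  Orthogonality in the form used below: \<open>X\<close> is orthogonal to everything measurable at time \<open>t\<close>
  as soon as its conditional expectation at time \<open>t\<close> vanishes.
\<close>

lemma integral_mult_E_eq_0:
  assumes "V \<in> borel_measurable (F t)" "square_integrable M V" "square_integrable M X"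
    and "AE \<omega> in M. E t X \<omega> = 0"
  shows "(\<integral>\<omega>. V \<omega> * X \<omega> \<partial>M) = 0"
proof -
  have [measurable]: "V \<in> borel_measurable M" using assms by simp
  have "(\<integral>\<omega>. V \<omega> * E t X \<omega> \<partial>M) = (\<integral>\<omega>. 0 \<partial>M)"
    using assms(4) by (intro integral_cong_AE) auto
  then show ?thesis using integral_mult_E[OF assms(1-3)] by simp
qed

lemma E_P_eq_0:
  assumes "square_integrable M X"
  shows "AE \<omega> in M. E (t - 1) (P t X) \<omega> = 0"
proof -
  have "AE \<omega> in M. E (t - 1) (\<lambda>\<omega>. E t X \<omega> - E (t - 1) X \<omega>) \<omega> =
      E (t - 1) (E t X) \<omega> - E (t - 1) (E (t - 1) X) \<omega>"
    by (intro cond.real_cond_exp_diff square_integrable_integrable square_integrable_E assms)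
  with E_E[of "t - 1" t X] E_E[of "t - 1" "t - 1" X] assms show ?thesis
    by (auto simp: projection_def[abs_def])
qed

lemma pythagoras_P:
  assumes "square_integrable M X"
  shows "(l2_norm M (E t X))\<^sup>2 = (l2_norm M (E (t - 1) X))\<^sup>2 + (l2_norm M (P t X))\<^sup>2"
proof -
  note sq = square_integrable_E[OF assms, of t] square_integrable_E[OF assms, of "t - 1"]
    square_integrable_P[OF assms, of t]
  have 0: "(\<integral>\<omega>. E (t - 1) X \<omega> * P t X \<omega> \<partial>M) = 0"
    using sq E_P_eq_0[OF assms] by (intro integral_mult_E_eq_0[of _ "t - 1"]) auto
  have "(l2_norm M (E t X))\<^sup>2 = (\<integral>\<omega>. (E (t - 1) X \<omega>)\<^sup>2 + (P t X \<omega>)\<^sup>2 + 2 * (E (t - 1) X \<omega> * P t X \<omega>) \<partial>M)"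
    unfolding l2_norm_square by (simp add: projection_def power2_eq_square algebra_simps)
  also have "\<dots> = (l2_norm M (E (t - 1) X))\<^sup>2 + (l2_norm M (P t X))\<^sup>2"
    using sq square_integrable_mult[OF sq(2,3)] 0 by (simp add: square_integrable_def l2_norm_square)
  finally show ?thesis .
qed

text \<open>
  The increments \<open>P\<^sub>t X\<close> are orthogonal to each other and to the conditional expectation at the
  starting time, so that second moments add up.
\<close>

lemma E_telescope:
  assumes "square_integrable M X"
  shows "(l2_norm M (E n X))\<^sup>2 =
    (l2_norm M (E (n - int L) X))\<^sup>2 + (\<Sum>t\<in>{n - int L<..n}. (l2_norm M (P t X))\<^sup>2)"
proof (induction L)
  case (Suc L)
  have "{n - int (Suc L)<..n} = insert (n - int L) {n - int L<..n}" by auto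
  then show ?case using Suc pythagoras_P[OF assms, of "n - int L"] by (simp add: algebra_simps)
qed simp

lemma P_sum:
  assumes "\<And>i. square_integrable M (X i)"
  shows "AE \<omega> in M. P t (\<lambda>\<omega>. \<Sum>i\<in>I. X i \<omega>) \<omega> = (\<Sum>i\<in>I. P t (X i) \<omega>)"
  using cond.real_cond_exp_sum[of X, where t = t and I = I] cond.real_cond_exp_sum[of X, where t = "t - 1" and I = I]
    square_integrable_integrable[OF assms] by (auto simp: projection_def sum_subtractf)

lemma P_diff:
  assumes "square_integrable M X" "square_integrable M Y"
  shows "AE \<omega> in M. P t (\<lambda>\<omega>. X \<omega> - Y \<omega>) \<omega> = P t X \<omega> - P t Y \<omega>"
  using cond.real_cond_exp_diff[of X Y, where t = t] cond.real_cond_exp_diff[of X Y, where t = "t - 1"]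
    assms[THEN square_integrable_integrable] by (auto simp: projection_def)

lemma P_cmult:
  assumes "square_integrable M X"
  shows "AE \<omega> in M. P t (\<lambda>\<omega>. c * X \<omega>) \<omega> = c * P t X \<omega>"
  using cond.real_cond_exp_cmult[of X, where t = t and c = c] cond.real_cond_exp_cmult[of X, where t = "t - 1" and c = c]
    assms[THEN square_integrable_integrable] by (auto simp: projection_def right_diff_distrib)

lemma P_eq_0_of_measurable:
  assumes "X \<in> borel_measurable (F s)" "s < t" "square_integrable M X"
  shows "AE \<omega> in M. P t X \<omega> = 0"
  using E_eq_self[OF measurable_F_mono[OF assms(1)] assms(3), of t]
    E_eq_self[OF measurable_F_mono[OF assms(1)] assms(3), of "t - 1"] assms(2)
  by (auto simp: projection_def)

text \<open>
  A martingale difference at time \<open>s\<close> is its own projection at time \<open>s\<close>; before \<open>s\<close> it is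
  invisible by the tower property, and after \<open>s\<close> it is already known.
\<close>

lemma P_martingale_difference:
  assumes X: "X \<in> borel_measurable (F s)" "square_integrable M X" and 0: "AE \<omega> in M. E (s - 1) X \<omega> = 0"
  shows "AE \<omega> in M. P t X \<omega> = (if t = s then X \<omega> else 0)"
proof -
  consider "t = s" | "t < s" | "s < t" by linarith
  then show ?thesis
  proof cases
    case 1
    then show ?thesis using 0 E_eq_self[OF X] by (auto simp: projection_def)
  next
    case 2
    have m: "AE \<omega> in M. E r X \<omega> = 0" if r: "r \<le> s - 1" for r
    proof -
      have "AE \<omega> in M. E r X \<omega> = E r (E (s - 1) X) \<omega>"
        using E_E[OF r X(2)] by auto
      moreover have "AE \<omega> in M. E r (E (s - 1) X) \<omega> = E r (\<lambda>_. 0) \<omega>"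
        using 0 by (intro cond.real_cond_exp_cong) auto
      moreover have "AE \<omega> in M. E r (\<lambda>_. 0) \<omega> = 0"
        by (intro cond.real_cond_exp_F_meas) auto
      ultimately show ?thesis by auto
    qed
    show ?thesis using m[of t] m[of "t - 1"] 2 by (auto simp: projection_def)
  next
    case 3
    then show ?thesis using P_eq_0_of_measurable[OF X(1) 3 X(2)] by auto
  qed
qed

end

section \<open>Asymptotic independence of the distant past\<close>

definition cov :: "'a measure \<Rightarrow> ('a \<Rightarrow> real) \<Rightarrow> ('a \<Rightarrow> real) \<Rightarrow> real" where
  "cov M V X = (\<integral>\<omega>. V \<omega> * X \<omega> \<partial>M) - (\<integral>\<omega>. V \<omega> \<partial>M) * (\<integral>\<omega>. X \<omega> \<partial>M)"

lemma (in prob_space) cov_add: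
  assumes "square_integrable M V" "square_integrable M X" "square_integrable M Y"
  shows "cov M V (\<lambda>\<omega>. X \<omega> + Y \<omega>) = cov M V X + cov M V Y"
  using assms[THEN square_integrable_integrable] square_integrable_mult[OF assms(1,2)]
    square_integrable_mult[OF assms(1,3)]
  by (simp add: cov_def distrib_left)

lemma cov_cmult: "cov M V (\<lambda>\<omega>. c * X \<omega>) = c * cov M V X"
  by (simp add: cov_def mult.left_commute[of _ c] right_diff_distrib)

lemma (in prob_space) cov_diff:
  assumes "square_integrable M V" "square_integrable M X" "square_integrable M Y"
  shows "cov M V (\<lambda>\<omega>. X \<omega> - Y \<omega>) = cov M V X - cov M V Y"
  using cov_add[OF assms(1,2) square_integrable_cmult[OF assms(3), of "-1"]]
    cov_cmult[of M V "-1" Y] by simp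

lemma (in prob_space) cov_le:
  assumes "square_integrable M V" "square_integrable M X"
  shows "\<bar>cov M V X\<bar> \<le> 2 * (l2_norm M V * l2_norm M X)"
proof -
  have "\<bar>\<integral>\<omega>. V \<omega> \<partial>M\<bar> \<le> l2_norm M V" "\<bar>\<integral>\<omega>. X \<omega> \<partial>M\<bar> \<le> l2_norm M X"
    using l1_le_l2_norm[OF assms(1)] l1_le_l2_norm[OF assms(2)]
      integral_abs_bound[of M V] integral_abs_bound[of M X] by linarith+
  then have "\<bar>(\<integral>\<omega>. V \<omega> \<partial>M) * (\<integral>\<omega>. X \<omega> \<partial>M)\<bar> \<le> l2_norm M V * l2_norm M X"
    unfolding abs_mult by (intro mult_mono) auto
  with l2_cauchy_schwarz_abs[OF assms] show ?thesis unfolding cov_def by linarith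
qed

context past_process
begin

text \<open>
  The test functions \<open>V\<close> range over the unit ball of the square-integrable functions of the past
  at time \<open>t - m\<close>. A bound over this ball controls the norm of a conditional expectation, and it
  also applies to the bounded functions \<open>cos\<close> and \<open>sin\<close> of partial sums. The lag \<open>m\<close> does not
  depend on \<open>t\<close>.
\<close>

definition decoupled :: "real \<Rightarrow> nat \<Rightarrow> ((nat \<Rightarrow> 's) \<Rightarrow> real) \<Rightarrow> bool" where
  "decoupled d m h \<longleftrightarrow> (\<forall>t V. V \<in> borel_measurable (F (t - int m)) \<longrightarrow> square_integrable M V \<longrightarrow>
     l2_norm M V \<le> 1 \<longrightarrow> \<bar>cov M V (\<lambda>\<omega>. h (past \<epsilon> t \<omega>))\<bar> \<le> d)"

definition mixing :: "((nat \<Rightarrow> 's) \<Rightarrow> real) \<Rightarrow> bool" where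
  "mixing h \<longleftrightarrow> h \<in> borel_measurable (past_space S) \<and> square_integrable M (\<lambda>\<omega>. h (past \<epsilon> 0 \<omega>)) \<and>
     (\<forall>d>0. \<exists>m. decoupled d m h)"

lemma decoupled_mono: "decoupled d m h \<Longrightarrow> m \<le> m' \<Longrightarrow> d \<le> d' \<Longrightarrow> decoupled d' m' h"
  unfolding decoupled_def
  by (meson measurable_F_mono diff_left_mono of_nat_le_iff order_trans)

lemma mixing_square_integrable: "mixing h \<Longrightarrow> square_integrable M (\<lambda>\<omega>. h (past \<epsilon> t \<omega>))"
  using past_law_square_integrable(1)[of h t 0] by (simp add: mixing_def)

lemma mixing_add:
  assumes "mixing g" "mixing h"
  shows "mixing (\<lambda>x. g x + h x)"
  unfolding mixing_def
proof (intro conjI allI impI)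
  fix d :: real assume "0 < d"
  then obtain m n where "decoupled (d / 2) m g" "decoupled (d / 2) n h"
    using assms unfolding mixing_def by (meson half_gt_zero)
  then have gh: "decoupled (d / 2) (max m n) g" "decoupled (d / 2) (max m n) h"
    by (auto intro: decoupled_mono)
  have "decoupled d (max m n) (\<lambda>x. g x + h x)"
    unfolding decoupled_def
  proof (intro allI impI)
    fix t V assume V: "V \<in> borel_measurable (F (t - int (max m n)))" "square_integrable M V" "l2_norm M V \<le> 1"
    with gh have "\<bar>cov M V (\<lambda>\<omega>. g (past \<epsilon> t \<omega>))\<bar> \<le> d / 2" "\<bar>cov M V (\<lambda>\<omega>. h (past \<epsilon> t \<omega>))\<bar> \<le> d / 2"
      by (simp_all add: decoupled_def)
    with cov_add[OF V(2) assms[THEN mixing_square_integrable]]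
    show "\<bar>cov M V (\<lambda>\<omega>. g (past \<epsilon> t \<omega>) + h (past \<epsilon> t \<omega>))\<bar> \<le> d" by simp
  qed
  then show "\<exists>m. decoupled d m (\<lambda>x. g x + h x)" ..
qed (use assms in \<open>auto simp: mixing_def intro: square_integrable_add\<close>)

lemma mixing_cmult:
  assumes "mixing h"
  shows "mixing (\<lambda>x. c * h x)"
  unfolding mixing_def
proof (intro conjI allI impI)
  fix d :: real assume d: "0 < d"
  then have "0 < d / (\<bar>c\<bar> + 1)" by (simp add: add_nonneg_pos)
  then obtain m where m: "decoupled (d / (\<bar>c\<bar> + 1)) m h"
    using assms unfolding mixing_def by meson
  have "\<bar>c\<bar> * x \<le> d" if "x \<le> d / (\<bar>c\<bar> + 1)" for x
  proof -
    have "\<bar>c\<bar> * x \<le> \<bar>c\<bar> * (d / (\<bar>c\<bar> + 1))" using that by (rule mult_left_mono) simp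
    also have "\<dots> \<le> d" using d by (simp add: field_simps)
    finally show ?thesis .
  qed
  then have "decoupled d m (\<lambda>x. c * h x)"
    using m unfolding decoupled_def by (simp add: cov_cmult abs_mult)
  then show "\<exists>m. decoupled d m (\<lambda>x. c * h x)" ..
qed (use assms in \<open>auto simp: mixing_def intro: square_integrable_cmult\<close>)

lemma mixing_cong:
  assumes "mixing h" "\<And>x. x \<in> space (past_space S) \<Longrightarrow> g x = h x"
  shows "mixing g"
proof -
  have *: "g (past \<epsilon> t \<omega>) = h (past \<epsilon> t \<omega>)" if "\<omega> \<in> space M" for t \<omega>
    using assms(2) past_in_space that by auto
  have "cov M V (\<lambda>\<omega>. g (past \<epsilon> t \<omega>)) = cov M V (\<lambda>\<omega>. h (past \<epsilon> t \<omega>))" for t V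
    unfolding cov_def using * by (simp cong: Bochner_Integration.integral_cong)
  moreover have "g \<in> borel_measurable (past_space S) \<longleftrightarrow> h \<in> borel_measurable (past_space S)"
    using assms(2) by (rule measurable_cong)
  moreover have "square_integrable M (\<lambda>\<omega>. g (past \<epsilon> 0 \<omega>)) \<longleftrightarrow> square_integrable M (\<lambda>\<omega>. h (past \<epsilon> 0 \<omega>))"
    unfolding square_integrable_def using *
    by (simp cong: measurable_cong Bochner_Integration.integrable_cong)
  ultimately show ?thesis using assms(1) by (simp add: mixing_def decoupled_def)
qed

lemma mixing_const: "mixing (\<lambda>_. c)"
proof -
  have "cov M V (\<lambda>_. c) = 0" for V by (simp add: cov_def prob_space mult.commute)
  then show ?thesis
    by (auto simp: mixing_def decoupled_def intro: square_integrable_bounded[of _ "\<bar>c\<bar>"])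
qed

lemma mixing_sum: "(\<And>i. i \<in> I \<Longrightarrow> mixing (h i)) \<Longrightarrow> mixing (\<lambda>x. \<Sum>i\<in>I. h i x)"
  by (induction I rule: infinite_finite_induct) (auto intro: mixing_add mixing_const)

text \<open>
  Mixing survives limits in mean square, since the covariance with the unit ball is continuous in
  that norm. The dominated form serves both for disjoint unions of events and for the passage from
  simple functions to all square-integrable ones.
\<close>

lemma mixing_dominated_limit:
  assumes h: "h \<in> borel_measurable (past_space S)"
    and H: "H \<in> borel_measurable (past_space S)" "square_integrable M (\<lambda>\<omega>. H (past \<epsilon> 0 \<omega>))"
    and mix: "\<And>n. mixing (s n)"
    and lim: "\<And>x. x \<in> space (past_space S) \<Longrightarrow> (\<lambda>n. s n x) \<longlonglongrightarrow> h x"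
    and bound: "\<And>n x. x \<in> space (past_space S) \<Longrightarrow> \<bar>s n x\<bar> \<le> H x"
  shows "mixing h"
proof -
  have sp: "past \<epsilon> t \<omega> \<in> space (past_space S)" if "\<omega> \<in> space M" for t \<omega>
    using past_in_space that by auto
  have [measurable]: "h \<in> borel_measurable (past_space S)" "H \<in> borel_measurable (past_space S)"
    "\<And>n. s n \<in> borel_measurable (past_space S)"
    using h H mix by (auto simp: mixing_def)
  have hH: "\<bar>h x\<bar> \<le> H x" if "x \<in> space (past_space S)" for x
    using tendsto_rabs[OF lim[OF that]] bound[OF that] by (intro LIMSEQ_le_const2) auto
  have H2: "integrable M (\<lambda>\<omega>. (H (past \<epsilon> 0 \<omega>))\<^sup>2)" using H by (simp add: square_integrable_def)
  have hsq: "square_integrable M (\<lambda>\<omega>. h (past \<epsilon> 0 \<omega>))"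
    unfolding square_integrable_def
  proof (intro conjI)
    show "integrable M (\<lambda>\<omega>. (h (past \<epsilon> 0 \<omega>))\<^sup>2)"
    proof (rule Bochner_Integration.integrable_bound[OF H2])
      show "AE \<omega> in M. norm ((h (past \<epsilon> 0 \<omega>))\<^sup>2) \<le> norm ((H (past \<epsilon> 0 \<omega>))\<^sup>2)"
        using hH[OF sp] by (auto intro!: AE_I2 power2_le_iff_abs_le[THEN iffD2] intro: order_trans[OF abs_ge_zero])
    qed measurable
  qed measurable
  have "(\<lambda>n. \<integral>\<omega>. (h (past \<epsilon> 0 \<omega>) - s n (past \<epsilon> 0 \<omega>))\<^sup>2 \<partial>M) \<longlonglongrightarrow> (\<integral>\<omega>. 0 \<partial>M)"
  proof (rule integral_dominated_convergence[where w="\<lambda>\<omega>. 4 * (H (past \<epsilon> 0 \<omega>))\<^sup>2"])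
    show "AE \<omega> in M. (\<lambda>n. (h (past \<epsilon> 0 \<omega>) - s n (past \<epsilon> 0 \<omega>))\<^sup>2) \<longlonglongrightarrow> 0"
    proof (rule AE_I2)
      fix \<omega> assume "\<omega> \<in> space M"
      then have "(\<lambda>n. (h (past \<epsilon> 0 \<omega>) - s n (past \<epsilon> 0 \<omega>))\<^sup>2) \<longlonglongrightarrow> (h (past \<epsilon> 0 \<omega>) - h (past \<epsilon> 0 \<omega>))\<^sup>2"
        by (intro tendsto_intros lim sp)
      then show "(\<lambda>n. (h (past \<epsilon> 0 \<omega>) - s n (past \<epsilon> 0 \<omega>))\<^sup>2) \<longlonglongrightarrow> 0" by simp
    qed
    show "AE \<omega> in M. norm ((h (past \<epsilon> 0 \<omega>) - s n (past \<epsilon> 0 \<omega>))\<^sup>2) \<le> 4 * (H (past \<epsilon> 0 \<omega>))\<^sup>2" for n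
    proof (rule AE_I2)
      fix \<omega> assume "\<omega> \<in> space M"
      from hH[OF sp[OF this, of 0]] bound[OF sp[OF this, of 0], of n]
      have "\<bar>h (past \<epsilon> 0 \<omega>) - s n (past \<epsilon> 0 \<omega>)\<bar> \<le> 2 * H (past \<epsilon> 0 \<omega>)" by linarith
      from power_mono[OF this abs_ge_zero, of 2]
      show "norm ((h (past \<epsilon> 0 \<omega>) - s n (past \<epsilon> 0 \<omega>))\<^sup>2) \<le> 4 * (H (past \<epsilon> 0 \<omega>))\<^sup>2"
        by (simp add: power_mult_distrib)
    qed
  qed (use H2 in auto)
  then have lim0: "(\<lambda>n. l2_norm M (\<lambda>\<omega>. h (past \<epsilon> 0 \<omega>) - s n (past \<epsilon> 0 \<omega>))) \<longlonglongrightarrow> 0"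
    unfolding l2_norm_def using tendsto_real_sqrt by fastforce
  show ?thesis
    unfolding mixing_def
  proof (intro conjI allI impI h hsq)
    fix d :: real assume d: "0 < d"
    then have "\<forall>\<^sub>F n in sequentially. l2_norm M (\<lambda>\<omega>. h (past \<epsilon> 0 \<omega>) - s n (past \<epsilon> 0 \<omega>)) < d / 4"
      using lim0 by (intro order_tendstoD) auto
    then obtain n where n: "l2_norm M (\<lambda>\<omega>. h (past \<epsilon> 0 \<omega>) - s n (past \<epsilon> 0 \<omega>)) < d / 4"
      by (auto simp: eventually_sequentially)
    obtain m where m: "decoupled (d / 2) m (s n)"
      using mix[of n] d unfolding mixing_def by (meson half_gt_zero)
    have "decoupled d m h"
      unfolding decoupled_def
    proof (intro allI impI)
      fix t V assume V: "V \<in> borel_measurable (F (t - int m))" "square_integrable M V" "l2_norm M V \<le> 1"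
      have sq: "square_integrable M (\<lambda>\<omega>. h (past \<epsilon> t \<omega>))" "square_integrable M (\<lambda>\<omega>. s n (past \<epsilon> t \<omega>))"
        using hsq past_law_square_integrable(1)[of h t 0] mixing_square_integrable[OF mix] by auto
      have "l2_norm M (\<lambda>\<omega>. h (past \<epsilon> t \<omega>) - s n (past \<epsilon> t \<omega>)) < d / 4"
        using n past_law_square_integrable(2)[of "\<lambda>x. h x - s n x" t 0] by simp
      then have "2 * (l2_norm M V * l2_norm M (\<lambda>\<omega>. h (past \<epsilon> t \<omega>) - s n (past \<epsilon> t \<omega>))) \<le> 2 * (1 * (d / 4))"
        using V by (intro mult_left_mono mult_mono) auto
      with cov_le[OF V(2) square_integrable_diff[OF sq]]
      have "\<bar>cov M V (\<lambda>\<omega>. h (past \<epsilon> t \<omega>)) - cov M V (\<lambda>\<omega>. s n (past \<epsilon> t \<omega>))\<bar> \<le> d / 2"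
        using cov_diff[OF V(2) sq] by simp
      moreover have "\<bar>cov M V (\<lambda>\<omega>. s n (past \<epsilon> t \<omega>))\<bar> \<le> d / 2"
        using m V by (simp add: decoupled_def)
      ultimately show "\<bar>cov M V (\<lambda>\<omega>. h (past \<epsilon> t \<omega>))\<bar> \<le> d" by linarith
    qed
    then show "\<exists>m. decoupled d m h" ..
  qed
qed

text \<open>
  An event about the last \<open>m\<close> innovations is independent of the past at time \<open>t - m\<close>, because
  the two depend on disjoint sets of innovations.
\<close>

lemma cov_cylinder_eq_0:
  assumes J: "finite J" "J \<subseteq> {..<m}" and C: "\<And>j. j \<in> J \<Longrightarrow> C j \<in> sets S"
    and V: "V \<in> borel_measurable (F (t - int m))" "integrable M V"
  shows "cov M V (\<lambda>\<omega>. indicator {x\<in>space (past_space S). \<forall>j\<in>J. x j \<in> C j} (past \<epsilon> t \<omega>)) = 0"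
proof -
  define s where "s = t - int m"
  define X1 X2 where "X1 \<omega> = restrict (\<lambda>i. \<epsilon> i \<omega>) {..s}" and "X2 \<omega> = restrict (\<lambda>i. \<epsilon> i \<omega>) {s<..}" for \<omega>
  have ind: "indep_var (PiM {..s} (\<lambda>_. S)) X1 (PiM {s<..} (\<lambda>_. S)) X2"
    unfolding X1_def X2_def by (rule indep_var_restrict[OF indep]) auto
  obtain v where v: "v \<in> borel_measurable (past_space S)" "\<And>\<omega>. \<omega> \<in> space M \<Longrightarrow> V \<omega> = v (past \<epsilon> s \<omega>)"
    using measurable_F_factor[OF V(1)[folded s_def]] by blast
  define \<phi> where "\<phi> x = (\<lambda>l. x (s - int l))" for x :: "int \<Rightarrow> 's"
  define A where "A = {y \<in> space (PiM {s<..} (\<lambda>_. S)). \<forall>j\<in>J. y (t - int j) \<in> C j}"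
  have J': "t - int j \<in> {s<..}" if "j \<in> J" for j using J that by (auto simp: s_def)
  have "\<phi> \<in> PiM {..s} (\<lambda>_. S) \<rightarrow>\<^sub>M past_space S"
    unfolding \<phi>_def past_space_def
    by (rule measurable_PiM_single') (auto simp: space_PiM PiE_mem)
  then have m1: "v \<circ> \<phi> \<in> borel_measurable (PiM {..s} (\<lambda>_. S))"
    using v(1) by (rule measurable_comp)
  have "A = {y \<in> space (PiM {s<..} (\<lambda>_. S)). \<forall>j\<in>J. y (t - int j) \<in> C j}" by (simp add: A_def)
  also have "\<dots> \<in> sets (PiM {s<..} (\<lambda>_. S))"
  proof (rule sets.sets_Collect_finite_All[OF _ J(1)])
    fix j assume j: "j \<in> J"
    have "(\<lambda>y. y (t - int j)) \<in> PiM {s<..} (\<lambda>_. S) \<rightarrow>\<^sub>M S"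
      by (rule measurable_component_singleton[OF J'[OF j]])
    from measurable_sets[OF this C[OF j]]
    show "{y \<in> space (PiM {s<..} (\<lambda>_. S)). y (t - int j) \<in> C j} \<in> sets (PiM {s<..} (\<lambda>_. S))"
      by (simp add: vimage_def Int_def conj_commute)
  qed
  finally have m2: "(indicator A :: _ \<Rightarrow> real) \<in> borel_measurable (PiM {s<..} (\<lambda>_. S))"
    by (rule borel_measurable_indicator)
  have e1: "V \<omega> = (v \<circ> \<phi> \<circ> X1) \<omega>" if "\<omega> \<in> space M" for \<omega>
  proof -
    have "\<phi> (X1 \<omega>) = past \<epsilon> s \<omega>" by (auto simp: \<phi>_def X1_def past_def fun_eq_iff)
    then show ?thesis using v(2)[OF that] by simp
  qed
  have e2: "indicator {x\<in>space (past_space S). \<forall>j\<in>J. x j \<in> C j} (past \<epsilon> t \<omega>) = (indicator A \<circ> X2 :: _ \<Rightarrow> real) \<omega>"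
    if "\<omega> \<in> space M" for \<omega>
  proof -
    have "past \<epsilon> t \<omega> \<in> space (past_space S)" using past_in_space that by auto
    moreover have "X2 \<omega> \<in> space (PiM {s<..} (\<lambda>_. S))"
      unfolding X2_def space_PiM using measurable_space[OF innovation_measurable that] by auto
    moreover have "X2 \<omega> (t - int j) = past \<epsilon> t \<omega> j" if "j \<in> J" for j
      using J'[OF that] by (simp add: X2_def past_def)
    ultimately show ?thesis by (auto simp: A_def indicator_def)
  qed
  have i2: "integrable M (indicator A \<circ> X2 :: _ \<Rightarrow> real)"
  proof (rule integrable_const_bound[where B=1])
    show "(indicator A \<circ> X2 :: _ \<Rightarrow> real) \<in> borel_measurable M"
      using measurable_comp[OF indep_var_rv2[OF ind] m2] .
  qed (auto simp: indicator_def)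
  have "integrable M (v \<circ> \<phi> \<circ> X1)"
    using V(2) e1 by (metis (no_types, lifting) Bochner_Integration.integrable_cong)
  from indep_var_lebesgue_integral[OF indep_var_compose[OF ind m1 m2] this i2]
  show ?thesis
    unfolding cov_def using e1 e2 by (simp cong: Bochner_Integration.integral_cong)
qed

text \<open>
  The events with mixing indicators form a Dynkin system containing the cylinders, which generate
  the product algebra and are stable under intersection.
\<close>

lemma mixing_indicator:
  assumes "A \<in> sets (past_space S)"
  shows "mixing (indicator A)"
proof -
  let ?G = "prod_algebra UNIV (\<lambda>_::nat. S)"
  let ?O = "\<Pi>\<^sub>E i\<in>(UNIV::nat set). space S"
  have sets: "sets (past_space S) = sigma_sets ?O ?G" unfolding past_space_def by (rule sets_PiM)
  have spc: "space (past_space S) = ?O" by (simp add: past_space_def space_PiM)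
  have ind_sq: "square_integrable M (\<lambda>\<omega>. indicator A (past \<epsilon> 0 \<omega>))" if "A \<in> sets (past_space S)" for A
    using that by (intro square_integrable_bounded[of _ 1]) (auto simp: indicator_def)
  have "A \<in> sigma_sets ?O ?G" using assms sets by simp
  with Int_stable_prod_algebra prod_algebra_sets_into_space show ?thesis
  proof (induction rule: sigma_sets_induct_disjoint)
    case (basic A)
    from prod_algebraE[OF this] obtain J C where J: "finite J" and C: "\<And>i. i \<in> J \<Longrightarrow> C i \<in> sets S"
      and A: "A = prod_emb UNIV (\<lambda>_. S) J (Pi\<^sub>E J C)" by metis
    have A': "A = {x\<in>space (past_space S). \<forall>j\<in>J. x j \<in> C j}"
      using A by (auto simp: prod_emb_def spc PiE_iff)
    have Am: "A \<in> sets (past_space S)"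
      unfolding sets by (rule sigma_sets.Basic[OF basic])
    obtain m where m: "J \<subseteq> {..<m}" using J finite_nat_bounded by blast
    have "decoupled 0 m (indicator A)"
      unfolding decoupled_def A' using cov_cylinder_eq_0[OF J m C] square_integrable_integrable by auto
    then have "decoupled d m (indicator A)" if "0 < d" for d
      using decoupled_mono[of 0 m "indicator A" m d] that by simp
    then show ?case unfolding mixing_def using Am ind_sq[OF Am] by auto
  next
    case empty
    show ?case using mixing_const[of 0] by (rule mixing_cong) simp
  next
    case (compl A)
    have "mixing (\<lambda>x. 1 + (-1) * indicator A x)"
      by (intro mixing_add mixing_const mixing_cmult compl)
    then show ?case by (rule mixing_cong) (auto simp: spc indicator_def)
  next
    case (union A)
    have Am: "A i \<in> sets (past_space S)" for i using union(2) sets by auto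
    show ?case
    proof (rule mixing_dominated_limit[where H="\<lambda>_. 1" and s="\<lambda>n x. \<Sum>i<n. indicator (A i) x"])
      show "mixing (\<lambda>x. \<Sum>i<n. indicator (A i) x)" for n
        by (intro mixing_sum union)
      have eq: "(\<Sum>i<n. indicator (A i) x) = (indicator (\<Union>i<n. A i) x :: real)" for n x
        using union(1) by (intro indicator_UN_disjoint[symmetric]) (auto simp: disjoint_family_on_def)
      show "(\<lambda>n. \<Sum>i<n. indicator (A i) x) \<longlonglongrightarrow> (indicator (\<Union>i. A i) x :: real)" for x
        unfolding eq by (rule LIMSEQ_indicator_UN)
      show "\<bar>\<Sum>i<n. indicator (A i) x\<bar> \<le> (1::real)" for n x
        unfolding eq by (simp add: indicator_def)
    qed (use Am in \<open>auto intro: square_integrable_bounded[of _ 1]\<close>)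
  qed
qed

lemma square_integrable_mixing:
  assumes h: "h \<in> borel_measurable (past_space S)" and sq: "square_integrable M (\<lambda>\<omega>. h (past \<epsilon> t \<omega>))"
  shows "mixing h"
proof -
  have sq0: "square_integrable M (\<lambda>\<omega>. h (past \<epsilon> 0 \<omega>))"
    using sq past_law_square_integrable(1)[OF h] by blast
  have step: "mixing f" if f: "simple_function (past_space S) f" for f :: "_ \<Rightarrow> real"
  proof (rule mixing_cong)
    show "mixing (\<lambda>x. \<Sum>y\<in>f ` space (past_space S). y * indicator (f -` {y} \<inter> space (past_space S)) x)"
      using f by (intro mixing_sum mixing_cmult mixing_indicator simple_functionD(2))
    show "f x = (\<Sum>y\<in>f ` space (past_space S). y * indicator (f -` {y} \<inter> space (past_space S)) x)"
      if "x \<in> space (past_space S)" for x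
      using simple_function_indicator_representation_banach[OF f that]
      unfolding real_scaleR_def by (subst mult.commute)
  qed
  from borel_measurable_implies_sequence_metric[OF h, of 0] obtain s where
    s: "\<And>i. simple_function (past_space S) (s i)"
    and lim: "\<And>x. x \<in> space (past_space S) \<Longrightarrow> (\<lambda>i. s i x) \<longlonglongrightarrow> h x"
    and bound: "\<And>i x. x \<in> space (past_space S) \<Longrightarrow> \<bar>s i x\<bar> \<le> 2 * \<bar>h x\<bar>"
    by (auto simp: dist_real_def) metis
  have "square_integrable M (\<lambda>\<omega>. \<bar>h (past \<epsilon> 0 \<omega>)\<bar>)" using sq0 by (auto simp: square_integrable_def)
  then have "square_integrable M (\<lambda>\<omega>. 2 * \<bar>h (past \<epsilon> 0 \<omega>)\<bar>)" by (rule square_integrable_cmult)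
  then show ?thesis
    using h by (intro mixing_dominated_limit[OF h _ _ step[OF s] lim bound]) auto
qed

text \<open>
  A form of Kolmogorov's zero-one law. If \<open>c\<close> is the norm of the conditional
  expectation of \<open>X\<close> at the distant time, then that conditional expectation divided by \<open>c\<close>
  lies in the unit ball and has covariance exactly \<open>c\<close> with \<open>X\<close>.
\<close>

lemma l2_norm_E_tendsto_0:
  assumes X: "X \<in> borel_measurable (F n)" "square_integrable M X" "(\<integral>\<omega>. X \<omega> \<partial>M) = 0" and d: "0 < d"
  shows "\<exists>m. l2_norm M (E (n - int m) X) \<le> d"
proof -
  obtain h where h: "h \<in> borel_measurable (past_space S)" "\<And>\<omega>. \<omega> \<in> space M \<Longrightarrow> X \<omega> = h (past \<epsilon> n \<omega>)"
    using measurable_F_factor[OF X(1)] by blast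
  have "square_integrable M (\<lambda>\<omega>. h (past \<epsilon> n \<omega>))"
    using h by (intro square_integrable_cong_AE[OF X(2)]) auto
  then have "mixing h" by (rule square_integrable_mixing[OF h(1)])
  then obtain m where m: "decoupled d m h" using d by (auto simp: mixing_def)
  define c where "c = l2_norm M (E (n - int m) X)"
  have "c \<le> d"
  proof (cases "c = 0")
    case False
    then have c: "0 < c" unfolding c_def by (simp add: less_le)
    define V where "V \<omega> = (1 / c) * E (n - int m) X \<omega>" for \<omega>
    have "l2_norm M V = \<bar>1 / c\<bar> * c"
      unfolding V_def[abs_def] l2_norm_cmult c_def ..
    moreover have "square_integrable M V"
      unfolding V_def[abs_def] by (intro square_integrable_cmult square_integrable_E X)
    moreover have "V \<in> borel_measurable (F (n - int m))"
      unfolding V_def[abs_def] by (intro borel_measurable_times E_measurable_F) auto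
    ultimately have V: "V \<in> borel_measurable (F (n - int m))" "square_integrable M V" "l2_norm M V \<le> 1"
      using c by simp_all
    have "cov M V (\<lambda>\<omega>. h (past \<epsilon> n \<omega>)) = cov M V X"
      unfolding cov_def using h(2) by (simp cong: Bochner_Integration.integral_cong)
    also have "\<dots> = (\<integral>\<omega>. V \<omega> * X \<omega> \<partial>M)" using X(3) by (simp add: cov_def)
    also have "\<dots> = (\<integral>\<omega>. V \<omega> * E (n - int m) X \<omega> \<partial>M)"
      using V X by (intro integral_mult_E[symmetric])
    also have "\<dots> = (1 / c) * (l2_norm M (E (n - int m) X))\<^sup>2"
      unfolding l2_norm_square V_def by (simp add: power2_eq_square mult.assoc)
    also have "\<dots> = c" using c by (simp add: c_def[symmetric] power2_eq_square)
    finally show ?thesis using m V unfolding decoupled_def by fastforce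
  qed (use d in simp)
  then show ?thesis unfolding c_def by blast
qed

text \<open>
  In the telescoping identity the term at the starting time tends to \<open>0\<close> as the starting time
  moves to \<open>-\<infinity>\<close>.
\<close>

lemma second_moment_le_projections:
  assumes X: "X \<in> borel_measurable (F n)" "square_integrable M X" "(\<integral>\<omega>. X \<omega> \<partial>M) = 0"
    and B: "\<And>L. (\<Sum>t\<in>{n - int L<..n}. (l2_norm M (P t X))\<^sup>2) \<le> B"
  shows "(l2_norm M X)\<^sup>2 \<le> B"
proof (rule field_le_epsilon)
  fix e :: real assume e: "0 < e"
  then obtain m where m: "l2_norm M (E (n - int m) X) \<le> sqrt e"
    using l2_norm_E_tendsto_0[OF X, of "sqrt e"] by auto
  have "(l2_norm M X)\<^sup>2 = (l2_norm M (E n X))\<^sup>2"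
    using l2_norm_cong_AE[OF _ _ E_eq_self[OF X(1,2)]] X by (simp add: square_integrable_def)
  also have "\<dots> \<le> (sqrt e)\<^sup>2 + B"
    unfolding E_telescope[OF X(2), of n m] using m by (intro add_mono B power_mono) auto
  finally show "(l2_norm M X)\<^sup>2 \<le> B + e" using e by simp
qed

end

section \<open>A central limit theorem for martingale differences\<close>

text \<open>
  The characteristic functions of successive partial sums satisfy such a recursion with
  \<open>q = 1 - v\<^sup>2 \<sigma>\<^sup>2 / 2\<close> and an error that is small compared with \<open>v\<^sup>2\<close>.
\<close>

lemma power_recursion_error:
  fixes a :: "nat \<Rightarrow> complex"
  assumes "a 0 = 1" "\<And>r. cmod (a (Suc r) - complex_of_real q * a r) \<le> e" "\<bar>q\<bar> \<le> 1"
  shows "cmod (a n - complex_of_real (q ^ n)) \<le> real n * e"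
proof (induction n)
  case (Suc n)
  have "cmod (a (Suc n) - complex_of_real (q ^ Suc n))
      = cmod ((a (Suc n) - q * a n) + q * (a n - complex_of_real (q ^ n)))"
    by (simp add: algebra_simps)
  also have "\<dots> \<le> cmod (a (Suc n) - q * a n) + \<bar>q\<bar> * cmod (a n - complex_of_real (q ^ n))"
    using norm_triangle_ineq by (metis norm_mult norm_of_real)
  also have "\<dots> \<le> e + 1 * (real n * e)"
    using assms Suc by (intro add_mono mult_mono) auto
  finally show ?case by (simp add: algebra_simps)
qed (use assms in simp)

lemma (in prob_space) iexp_times_integrable:
  fixes Z X :: "'a \<Rightarrow> real"
  assumes [measurable]: "Z \<in> borel_measurable M" and X: "integrable M X"
  shows "integrable M (\<lambda>\<omega>. iexp (Z \<omega>) * complex_of_real (X \<omega>))" (is ?int)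
    and "(CLINT \<omega>|M. iexp (Z \<omega>) * complex_of_real (X \<omega>)) =
      complex_of_real (\<integral>\<omega>. cos (Z \<omega>) * X \<omega> \<partial>M) + \<i> * complex_of_real (\<integral>\<omega>. sin (Z \<omega>) * X \<omega> \<partial>M)"
proof -
  have [measurable]: "X \<in> borel_measurable M" using X by simp
  have c: "integrable M (\<lambda>\<omega>. cos (Z \<omega>) * X \<omega>)"
  proof (rule Bochner_Integration.integrable_bound[OF X])
    show "AE \<omega> in M. norm (cos (Z \<omega>) * X \<omega>) \<le> norm (X \<omega>)"
      by (auto simp: abs_mult intro!: mult_left_le_one_le)
  qed measurable
  have s: "integrable M (\<lambda>\<omega>. sin (Z \<omega>) * X \<omega>)"
  proof (rule Bochner_Integration.integrable_bound[OF X])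
    show "AE \<omega> in M. norm (sin (Z \<omega>) * X \<omega>) \<le> norm (X \<omega>)"
      by (auto simp: abs_mult intro!: mult_left_le_one_le)
  qed measurable
  have eq: "iexp (Z \<omega>) * complex_of_real (X \<omega>) =
      complex_of_real (cos (Z \<omega>) * X \<omega>) + \<i> * complex_of_real (sin (Z \<omega>) * X \<omega>)" for \<omega>
    unfolding exp_Euler by (simp add: cos_of_real sin_of_real algebra_simps)
  show ?int unfolding eq
    using c s by (intro Bochner_Integration.integrable_add integrable_mult_right integrable_of_real)
  show "(CLINT \<omega>|M. iexp (Z \<omega>) * complex_of_real (X \<omega>)) =
      complex_of_real (\<integral>\<omega>. cos (Z \<omega>) * X \<omega> \<partial>M) + \<i> * complex_of_real (\<integral>\<omega>. sin (Z \<omega>) * X \<omega> \<partial>M)"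
    unfolding eq integral_complex_of_real[symmetric] integral_mult_right_zero[symmetric]
    using c s by (intro Bochner_Integration.integral_add integrable_mult_right integrable_of_real)
qed

text \<open>
  For a square-integrable variable in place of \<open>x\<close> the expectation of the minimum tends to \<open>0\<close>
  with \<open>v\<close> by dominated convergence, so that the remainder is \<open>o(v\<^sup>2)\<close> without third moments.
\<close>

lemma norm_iexp_quadratic_remainder:
  "cmod (iexp (v * x) - (1 + \<i> * complex_of_real (v * x) - complex_of_real ((v * x)\<^sup>2 / 2)))
    \<le> v\<^sup>2 * min (x\<^sup>2) (\<bar>v\<bar> * \<bar>x\<bar> ^ 3)"
proof -
  have s: "(\<Sum>k\<le>2. (\<i> * complex_of_real (v * x)) ^ k / fact k)
      = 1 + \<i> * complex_of_real (v * x) - complex_of_real ((v * x)\<^sup>2 / 2)"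
    by (simp add: numeral_2_eq_2 power_mult_distrib)
  have "cmod (iexp (v * x) - (\<Sum>k\<le>2. (\<i> * complex_of_real (v * x)) ^ k / fact k)) \<le> 2 * \<bar>v * x\<bar> ^ 2 / fact 2"
    by (rule iexp_approx2)
  also have "\<dots> = v\<^sup>2 * x\<^sup>2" by (simp add: power_mult_distrib)
  finally have 1: "cmod (iexp (v * x) - (\<Sum>k\<le>2. (\<i> * complex_of_real (v * x)) ^ k / fact k)) \<le> v\<^sup>2 * x\<^sup>2" .
  have "cmod (iexp (v * x) - (\<Sum>k\<le>2. (\<i> * complex_of_real (v * x)) ^ k / fact k)) \<le> \<bar>v * x\<bar> ^ Suc 2 / fact (Suc 2)"
    by (rule iexp_approx1)
  also have "\<dots> \<le> \<bar>v * x\<bar> ^ 3" by (simp add: fact_numeral)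
  also have "\<dots> = v\<^sup>2 * (\<bar>v\<bar> * \<bar>x\<bar> ^ 3)"
  proof -
    have "v\<^sup>2 = \<bar>v\<bar> * \<bar>v\<bar>" by (simp add: power2_eq_square)
    then show ?thesis unfolding abs_mult power3_eq_cube by (simp only: mult_ac)
  qed
  finally show ?thesis using 1 unfolding s by (simp add: min_def)
qed

locale past_martingale_difference = past_process M S \<epsilon>
  for M :: "'a measure" and S :: "'s measure" and \<epsilon> :: "int \<Rightarrow> 'a \<Rightarrow> 's" +
  fixes g :: "(nat \<Rightarrow> 's) \<Rightarrow> real"
  assumes g_measurable: "g \<in> borel_measurable (past_space S)"
    and g_square_integrable: "square_integrable M (\<lambda>\<omega>. g (past \<epsilon> 0 \<omega>))"
    and martingale_difference: "AE \<omega> in M. E (t - 1) (\<lambda>\<omega>. g (past \<epsilon> t \<omega>)) \<omega> = 0"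
begin

definition D :: "int \<Rightarrow> 'a \<Rightarrow> real" where
  "D t \<omega> = g (past \<epsilon> t \<omega>)"

definition T :: "nat \<Rightarrow> 'a \<Rightarrow> real" where
  "T r \<omega> = (\<Sum>t\<in>{1..int r}. D t \<omega>)"

definition \<sigma>2 :: real where
  "\<sigma>2 = (\<integral>\<omega>. (D 0 \<omega>)\<^sup>2 \<partial>M)"

lemma D_square_integrable: "square_integrable M (D t)"
  using past_law_square_integrable(1)[OF g_measurable, of t 0] g_square_integrable
  by (simp add: D_def[abs_def])

lemma D_measurable [measurable]: "D t \<in> borel_measurable M"
  using D_square_integrable by (simp add: square_integrable_def)

lemma D_measurable_F: "t \<le> s \<Longrightarrow> D t \<in> borel_measurable (F s)"
  unfolding D_def[abs_def] by (rule measurable_F_past[OF g_measurable])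

lemma D_integral:
  fixes q :: "real \<Rightarrow> real"
  assumes "q \<in> borel_measurable borel"
  shows "(\<integral>\<omega>. q (D t \<omega>) \<partial>M) = (\<integral>\<omega>. q (D 0 \<omega>) \<partial>M)"
  unfolding D_def by (rule past_law_integral(1)) (rule measurable_compose[OF g_measurable assms])

lemma D_l2_norm: "l2_norm M (D t) = l2_norm M (D 0)"
  unfolding D_def[abs_def] by (rule past_law_square_integrable(2)[OF g_measurable])

lemma T_measurable_F: "int r \<le> s \<Longrightarrow> T r \<in> borel_measurable (F s)"
  unfolding T_def[abs_def] by (intro borel_measurable_sum D_measurable_F) auto

lemma T_square_integrable: "square_integrable M (T r)"
  unfolding T_def[abs_def] by (intro square_integrable_sum D_square_integrable)

lemma T_measurable [measurable]: "T r \<in> borel_measurable M"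
  using T_square_integrable by (simp add: square_integrable_def)

lemma T_Suc: "T (Suc r) \<omega> = T r \<omega> + D (int r + 1) \<omega>"
proof -
  have "{1..int (Suc r)} = insert (int r + 1) {1..int r}" by auto
  then show ?thesis by (simp add: T_def)
qed

lemma \<sigma>2_nonneg: "0 \<le> \<sigma>2"
  by (simp add: \<sigma>2_def)

lemma T_increment:
  "s \<le> r \<Longrightarrow> (\<integral>\<omega>. \<bar>T r \<omega> - T s \<omega>\<bar> \<partial>M) \<le> real (r - s) * l2_norm M (D 0)"
proof -
  assume sr: "s \<le> r"
  have "T r \<omega> - T s \<omega> = (\<Sum>t\<in>{int s<..int r}. D t \<omega>)" for \<omega>
  proof -
    have "{1..int r} = {1..int s} \<union> {int s<..int r}" using sr by auto
    then have "T r \<omega> = T s \<omega> + (\<Sum>t\<in>{int s<..int r}. D t \<omega>)"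
      unfolding T_def by (subst sum.union_disjoint[symmetric]) auto
    then show ?thesis by simp
  qed
  then have "(\<integral>\<omega>. \<bar>T r \<omega> - T s \<omega>\<bar> \<partial>M) \<le> l2_norm M (\<lambda>\<omega>. \<Sum>t\<in>{int s<..int r}. D t \<omega>)"
    using l1_le_l2_norm[OF square_integrable_diff[OF T_square_integrable[of r] T_square_integrable[of s]]] by simp
  also have "\<dots> \<le> (\<Sum>t\<in>{int s<..int r}. l2_norm M (D t))"
    by (intro l2_norm_sum D_square_integrable)
  also have "\<dots> = (\<Sum>t\<in>{int s<..int r}. l2_norm M (D 0))"
    by (intro sum.cong refl D_l2_norm)
  also have "\<dots> = real (r - s) * l2_norm M (D 0)"
    using sr by (simp add: of_nat_diff)
  finally show ?thesis .
qed

text \<open>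
  The square \<open>D\<^sub>r\<^sub>+\<^sub>1\<^sup>2\<close> is close in mean to a bounded function of the past, which is nearly
  independent of \<open>T\<^sub>s\<close> when \<open>s\<close> lies a fixed number of steps back; and \<open>c (v T\<^sub>s)\<close> differs
  from \<open>c (v T\<^sub>r)\<close> by \<open>O(v)\<close> in mean. The function \<open>c\<close> stands for \<open>cos\<close> and \<open>sin\<close>.
\<close>

lemma cov_square_le:
  assumes d: "0 < d"
  shows "\<exists>B\<ge>0. \<forall>c v r. c \<in> borel_measurable borel \<longrightarrow> (\<forall>x. \<bar>c x\<bar> \<le> 1) \<longrightarrow> (\<forall>x y. \<bar>c x - c y\<bar> \<le> \<bar>x - y\<bar>) \<longrightarrow>
    \<bar>cov M (\<lambda>\<omega>. c (v * T r \<omega>)) (\<lambda>\<omega>. (D (int r + 1) \<omega>)\<^sup>2)\<bar> \<le> d + B * \<bar>v\<bar>"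
proof -
  have D2: "integrable M (\<lambda>\<omega>. (D t \<omega>)\<^sup>2)" for t
    using D_square_integrable by (simp add: square_integrable_def)
  have "(\<lambda>k. \<integral>\<omega>. (D 0 \<omega>)\<^sup>2 - min ((D 0 \<omega>)\<^sup>2) (real k) \<partial>M) \<longlonglongrightarrow> (\<integral>\<omega>. 0 \<partial>M)"
  proof (rule integral_dominated_convergence[where w="\<lambda>\<omega>. (D 0 \<omega>)\<^sup>2"])
    show "AE \<omega> in M. (\<lambda>k. (D 0 \<omega>)\<^sup>2 - min ((D 0 \<omega>)\<^sup>2) (real k)) \<longlonglongrightarrow> 0"
    proof (rule AE_I2)
      fix \<omega>
      obtain k0 where "(D 0 \<omega>)\<^sup>2 \<le> real k0" using real_arch_simple by blast
      then have "\<forall>\<^sub>F k in sequentially. (D 0 \<omega>)\<^sup>2 - min ((D 0 \<omega>)\<^sup>2) (real k) = 0"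
        by (intro eventually_sequentiallyI[of k0]) auto
      then show "(\<lambda>k. (D 0 \<omega>)\<^sup>2 - min ((D 0 \<omega>)\<^sup>2) (real k)) \<longlonglongrightarrow> 0" by (rule tendsto_eventually)
    qed
  qed (use D2 in auto)
  then have "\<forall>\<^sub>F k in sequentially. (\<integral>\<omega>. (D 0 \<omega>)\<^sup>2 - min ((D 0 \<omega>)\<^sup>2) (real k) \<partial>M) < d / 4"
    using d by (intro order_tendstoD) auto
  then obtain k where k: "(\<integral>\<omega>. (D 0 \<omega>)\<^sup>2 - min ((D 0 \<omega>)\<^sup>2) (real k) \<partial>M) < d / 4"
    by (auto simp: eventually_sequentially)
  define h where "h x = min ((g x)\<^sup>2) (real k)" for x
  have [measurable]: "h \<in> borel_measurable (past_space S)"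
    using g_measurable unfolding h_def[abs_def] by measurable
  have h_bound: "\<bar>h x\<bar> \<le> real k" for x by (simp add: h_def)
  have hsq: "square_integrable M (\<lambda>\<omega>. h (past \<epsilon> t \<omega>))" for t
    by (rule square_integrable_bounded[OF _ h_bound]) measurable
  then have "mixing h" by (intro square_integrable_mixing) auto
  then obtain m where m: "decoupled (d / 2) m h" using d unfolding mixing_def by (meson half_gt_zero)
  define B where "B = 2 * real k * (real m * l2_norm M (D 0))"
  have "\<bar>cov M (\<lambda>\<omega>. c (v * T r \<omega>)) (\<lambda>\<omega>. (D (int r + 1) \<omega>)\<^sup>2)\<bar> \<le> d + B * \<bar>v\<bar>"
    if [measurable]: "c \<in> borel_measurable borel" and c1: "\<And>x. \<bar>c x\<bar> \<le> 1"
      and c2: "\<And>x y. \<bar>c x - c y\<bar> \<le> \<bar>x - y\<bar>" for c v r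
  proof -
    \<comment> \<open>The subtraction is truncated: with fewer than \<open>m\<close> steps behind it, the comparison sum
      \<open>T s\<close> is the constant \<open>T 0 = 0\<close>, which is measurable at every time.\<close>
    define t s where "t = int r + 1" and "s = Suc r - m"
    define H where "H \<omega> = h (past \<epsilon> t \<omega>)" for \<omega>
    define V W where "V \<omega> = c (v * T r \<omega>)" and "W \<omega> = c (v * T (min r s) \<omega>)" for \<omega>
    have [measurable]: "V \<in> borel_measurable M" "W \<in> borel_measurable M" "H \<in> borel_measurable M"
      unfolding V_def[abs_def] W_def[abs_def] H_def[abs_def] by measurable
    have Hb: "\<bar>H \<omega>\<bar> \<le> real k" for \<omega> by (simp add: H_def h_bound)
    have VW: "\<bar>V \<omega>\<bar> \<le> 1" "\<bar>W \<omega>\<bar> \<le> 1" for \<omega> by (simp_all add: V_def W_def c1)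
    have sq: "square_integrable M V" "square_integrable M W" "square_integrable M H"
      by (rule square_integrable_bounded[OF _ VW(1)] square_integrable_bounded[OF _ VW(2)]
          square_integrable_bounded[OF _ Hb]; measurable)+
    have R: "0 \<le> (D t \<omega>)\<^sup>2 - H \<omega>" for \<omega> by (simp add: H_def h_def D_def)
    have Ri: "integrable M (\<lambda>\<omega>. (D t \<omega>)\<^sup>2 - H \<omega>)"
      using D2 square_integrable_integrable[OF sq(3)] by simp
    have "(\<integral>\<omega>. (D t \<omega>)\<^sup>2 - H \<omega> \<partial>M) = (\<integral>\<omega>. (D t \<omega>)\<^sup>2 - min ((D t \<omega>)\<^sup>2) (real k) \<partial>M)"
      by (simp add: H_def h_def D_def)
    also have "\<dots> = (\<integral>\<omega>. (D 0 \<omega>)\<^sup>2 - min ((D 0 \<omega>)\<^sup>2) (real k) \<partial>M)"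
      by (rule D_integral) measurable
    finally have Rd: "(\<integral>\<omega>. (D t \<omega>)\<^sup>2 - H \<omega> \<partial>M) \<le> d / 4" using k by simp
    have VRi: "integrable M (\<lambda>\<omega>. V \<omega> * ((D t \<omega>)\<^sup>2 - H \<omega>))"
      by (rule Bochner_Integration.integrable_bound[OF Ri])
         (use VW R in \<open>auto simp: abs_mult intro!: mult_left_le_one_le\<close>)
    have "\<bar>\<integral>\<omega>. V \<omega> * ((D t \<omega>)\<^sup>2 - H \<omega>) \<partial>M\<bar> \<le> (\<integral>\<omega>. \<bar>V \<omega> * ((D t \<omega>)\<^sup>2 - H \<omega>)\<bar> \<partial>M)"
      by (rule integral_abs_bound)
    also have "\<dots> \<le> (\<integral>\<omega>. (D t \<omega>)\<^sup>2 - H \<omega> \<partial>M)"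
      using VRi Ri VW R by (intro integral_mono integrable_abs) (auto simp: abs_mult intro!: mult_left_le_one_le)
    finally have R1: "\<bar>\<integral>\<omega>. V \<omega> * ((D t \<omega>)\<^sup>2 - H \<omega>) \<partial>M\<bar> \<le> d / 4" using Rd by simp
    have EV: "\<bar>\<integral>\<omega>. V \<omega> \<partial>M\<bar> \<le> 1"
    proof -
      have "\<bar>\<integral>\<omega>. V \<omega> \<partial>M\<bar> \<le> (\<integral>\<omega>. \<bar>V \<omega>\<bar> \<partial>M)" by (rule integral_abs_bound)
      also have "\<dots> \<le> (\<integral>\<omega>. 1 \<partial>M)"
        using sq(1) VW by (intro integral_mono) (auto intro: square_integrable_integrable)
      finally show ?thesis by (simp add: prob_space)
    qed
    have R0: "0 \<le> (\<integral>\<omega>. (D t \<omega>)\<^sup>2 - H \<omega> \<partial>M)" using R by (intro integral_nonneg_AE) auto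
    have R2: "\<bar>(\<integral>\<omega>. V \<omega> \<partial>M) * (\<integral>\<omega>. (D t \<omega>)\<^sup>2 - H \<omega> \<partial>M)\<bar> \<le> 1 * (d / 4)"
      unfolding abs_mult using EV Rd R0
      by (intro mult_mono) auto
    have VHi: "integrable M (\<lambda>\<omega>. V \<omega> * H \<omega>)" by (rule square_integrable_mult[OF sq(1,3)])
    have "cov M V (\<lambda>\<omega>. (D t \<omega>)\<^sup>2) = cov M V (\<lambda>\<omega>. (D t \<omega>)\<^sup>2 - H \<omega>) + cov M V H"
    proof -
      have "(\<integral>\<omega>. V \<omega> * (D t \<omega>)\<^sup>2 \<partial>M) = (\<integral>\<omega>. V \<omega> * ((D t \<omega>)\<^sup>2 - H \<omega>) \<partial>M) + (\<integral>\<omega>. V \<omega> * H \<omega> \<partial>M)"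
        by (subst Bochner_Integration.integral_add[OF VRi VHi, symmetric]) (simp add: algebra_simps)
      moreover have "(\<integral>\<omega>. (D t \<omega>)\<^sup>2 \<partial>M) = (\<integral>\<omega>. (D t \<omega>)\<^sup>2 - H \<omega> \<partial>M) + (\<integral>\<omega>. H \<omega> \<partial>M)"
        using D2 square_integrable_integrable[OF sq(3)] by simp
      ultimately show ?thesis by (simp add: cov_def algebra_simps)
    qed
    moreover have "\<bar>cov M V (\<lambda>\<omega>. (D t \<omega>)\<^sup>2 - H \<omega>)\<bar> \<le> d / 2"
      using R1 R2 unfolding cov_def by linarith
    moreover have "\<bar>cov M W H\<bar> \<le> d / 2"
    proof -
      have "W \<in> borel_measurable (F (t - int m))"
      proof (cases "m \<le> Suc r")
        case True
        then have "int (min r s) \<le> t - int m" by (auto simp: t_def s_def)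
        from T_measurable_F[OF this] show ?thesis unfolding W_def[abs_def] by measurable
      next
        case False
        then have "W = (\<lambda>_. c 0)" by (simp add: W_def[abs_def] s_def T_def)
        then show ?thesis by simp
      qed
      moreover have "l2_norm M W \<le> 1"
      proof -
        have "(\<integral>\<omega>. (W \<omega>)\<^sup>2 \<partial>M) \<le> (\<integral>\<omega>. 1 \<partial>M)"
          using sq(2) VW(2) power2_le_iff_abs_le[of 1] 
          by (intro integral_mono) (auto simp: square_integrable_def abs_square_le_1)
        then show ?thesis by (simp add: l2_norm_def prob_space)
      qed
      ultimately show ?thesis using m sq(2) unfolding decoupled_def H_def[abs_def] by blast
    qed
    moreover have "\<bar>cov M V H - cov M W H\<bar> \<le> B * \<bar>v\<bar>"
    proof -
      have i: "integrable M (\<lambda>\<omega>. \<bar>T r \<omega> - T (min r s) \<omega>\<bar>)"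
        by (intro integrable_abs square_integrable_integrable square_integrable_diff T_square_integrable)
      have dVW: "\<bar>V \<omega> - W \<omega>\<bar> \<le> \<bar>v\<bar> * \<bar>T r \<omega> - T (min r s) \<omega>\<bar>" for \<omega>
        using c2[of "v * T r \<omega>" "v * T (min r s) \<omega>"]
        by (simp add: V_def W_def abs_mult flip: right_diff_distrib)
      have "r - min r s \<le> m" by (auto simp: s_def)
      then have "real (r - min r s) * l2_norm M (D 0) \<le> real m * l2_norm M (D 0)"
        by (intro mult_right_mono) auto
      then have TT: "(\<integral>\<omega>. \<bar>T r \<omega> - T (min r s) \<omega>\<bar> \<partial>M) \<le> real m * l2_norm M (D 0)"
        using T_increment[of "min r s" r] by linarith
      have VWi: "integrable M (\<lambda>\<omega>. \<bar>V \<omega> - W \<omega>\<bar>)"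
        by (intro integrable_abs square_integrable_integrable square_integrable_diff sq)
      have "(\<integral>\<omega>. \<bar>V \<omega> - W \<omega>\<bar> \<partial>M) \<le> (\<integral>\<omega>. \<bar>v\<bar> * \<bar>T r \<omega> - T (min r s) \<omega>\<bar> \<partial>M)"
        using i VWi dVW by (intro integral_mono) auto
      also have "\<dots> \<le> \<bar>v\<bar> * (real m * l2_norm M (D 0))"
        using TT by (simp add: mult_left_mono)
      finally have VW1: "(\<integral>\<omega>. \<bar>V \<omega> - W \<omega>\<bar> \<partial>M) \<le> \<bar>v\<bar> * (real m * l2_norm M (D 0))" .
      have "\<bar>\<integral>\<omega>. (V \<omega> - W \<omega>) * H \<omega> \<partial>M\<bar> \<le> (\<integral>\<omega>. \<bar>(V \<omega> - W \<omega>) * H \<omega>\<bar> \<partial>M)"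
        by (rule integral_abs_bound)
      also have "\<dots> \<le> (\<integral>\<omega>. \<bar>V \<omega> - W \<omega>\<bar> * real k \<partial>M)"
        using VWi Hb square_integrable_mult[OF square_integrable_diff[OF sq(1,2)] sq(3)]
        by (intro integral_mono integrable_abs) (auto simp: abs_mult intro!: mult_left_mono)
      finally have 1: "\<bar>\<integral>\<omega>. (V \<omega> - W \<omega>) * H \<omega> \<partial>M\<bar> \<le> (\<integral>\<omega>. \<bar>V \<omega> - W \<omega>\<bar> \<partial>M) * real k" by simp
      have "\<bar>\<integral>\<omega>. H \<omega> \<partial>M\<bar> \<le> (\<integral>\<omega>. \<bar>H \<omega>\<bar> \<partial>M)" by (rule integral_abs_bound)
      also have "\<dots> \<le> (\<integral>\<omega>. real k \<partial>M)"
        using sq(3) Hb by (intro integral_mono) (auto intro: square_integrable_integrable)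
      finally have "\<bar>\<integral>\<omega>. H \<omega> \<partial>M\<bar> \<le> real k" by (simp add: prob_space)
      then have 2: "\<bar>(\<integral>\<omega>. V \<omega> - W \<omega> \<partial>M) * (\<integral>\<omega>. H \<omega> \<partial>M)\<bar> \<le> (\<integral>\<omega>. \<bar>V \<omega> - W \<omega>\<bar> \<partial>M) * real k"
        unfolding abs_mult using integral_abs_bound[of M "\<lambda>\<omega>. V \<omega> - W \<omega>"] by (intro mult_mono) auto
      have "cov M V H - cov M W H
          = (\<integral>\<omega>. (V \<omega> - W \<omega>) * H \<omega> \<partial>M) - (\<integral>\<omega>. V \<omega> - W \<omega> \<partial>M) * (\<integral>\<omega>. H \<omega> \<partial>M)"
        using sq[THEN square_integrable_integrable] square_integrable_mult[OF sq(1,3)]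
          square_integrable_mult[OF sq(2,3)]
        by (simp add: cov_def left_diff_distrib)
      then have "\<bar>cov M V H - cov M W H\<bar> \<le> 2 * ((\<integral>\<omega>. \<bar>V \<omega> - W \<omega>\<bar> \<partial>M) * real k)"
        using 1 2 by linarith
      also have "\<dots> \<le> 2 * (\<bar>v\<bar> * (real m * l2_norm M (D 0)) * real k)"
        using VW1 by (intro mult_left_mono mult_right_mono) auto
      finally show ?thesis by (simp add: B_def mult_ac)
    qed
    ultimately show ?thesis unfolding V_def t_def by linarith
  qed
  moreover have "0 \<le> B" by (simp add: B_def)
  ultimately show ?thesis by blast
qed

text \<open>
  Expand \<open>exp (i v D\<^sub>r\<^sub>+\<^sub>1)\<close> to second order under the integral. The linear term vanishes since
  \<open>exp (i v T\<^sub>r)\<close> is known at time \<open>r\<close>; replacing \<open>D\<^sub>r\<^sub>+\<^sub>1\<^sup>2\<close> by its mean costs the two covariances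
  in the hypothesis.
\<close>

lemma char_step:
  assumes d: "\<And>c. c = cos \<or> c = sin \<Longrightarrow> \<bar>cov M (\<lambda>\<omega>. c (v * T r \<omega>)) (\<lambda>\<omega>. (D (int r + 1) \<omega>)\<^sup>2)\<bar> \<le> d"
  shows "cmod ((CLINT \<omega>|M. iexp (v * T (Suc r) \<omega>)) - complex_of_real (1 - v\<^sup>2 * \<sigma>2 / 2) * (CLINT \<omega>|M. iexp (v * T r \<omega>)))
    \<le> v\<^sup>2 * ((\<integral>\<omega>. min ((D 0 \<omega>)\<^sup>2) (\<bar>v\<bar> * \<bar>D 0 \<omega>\<bar> ^ 3) \<partial>M) + d)"
proof -
  define Z X where "Z \<omega> = v * T r \<omega>" and "X = D (int r + 1)" for \<omega>
  have [measurable]: "Z \<in> borel_measurable M" "X \<in> borel_measurable M"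
    unfolding Z_def[abs_def] X_def by measurable
  have X: "square_integrable M X" unfolding X_def by (rule D_square_integrable)
  have X2: "integrable M (\<lambda>\<omega>. (X \<omega>)\<^sup>2)" using X by (simp add: square_integrable_def)
  have zero: "(\<integral>\<omega>. c (Z \<omega>) * X \<omega> \<partial>M) = 0" if c: "c = cos \<or> c = sin" for c :: "real \<Rightarrow> real"
  proof (rule integral_mult_E_eq_0[of _ "int r"])
    have [measurable]: "c \<in> borel_measurable borel" using c by auto
    have "T r \<in> borel_measurable (F (int r))" by (rule T_measurable_F) simp
    then show "(\<lambda>\<omega>. c (Z \<omega>)) \<in> borel_measurable (F (int r))" unfolding Z_def by measurable
    show "square_integrable M (\<lambda>\<omega>. c (Z \<omega>))"
      using c by (intro square_integrable_bounded[where B=1]) auto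
    show "AE \<omega> in M. E (int r) X \<omega> = 0"
      using martingale_difference[of "int r + 1"] by (simp add: X_def D_def[abs_def])
  qed (rule X)
  note iX = iexp_times_integrable[OF \<open>Z \<in> borel_measurable M\<close> square_integrable_integrable[OF X]]
  note iX2 = iexp_times_integrable[OF \<open>Z \<in> borel_measurable M\<close> X2]
  have i1: "integrable M (\<lambda>\<omega>. 1::real)" by simp
  note i1 = iexp_times_integrable[OF \<open>Z \<in> borel_measurable M\<close> i1]
  have D0: "(CLINT \<omega>|M. iexp (Z \<omega>) * complex_of_real (X \<omega>)) = 0"
    unfolding iX(2) using zero[of cos] zero[of sin] by simp
  have cov2: "cmod ((CLINT \<omega>|M. iexp (Z \<omega>) * complex_of_real ((X \<omega>)\<^sup>2)) - complex_of_real \<sigma>2 * (CLINT \<omega>|M. iexp (Z \<omega>))) \<le> 2 * d"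
  proof -
    have s: "(\<integral>\<omega>. (X \<omega>)\<^sup>2 \<partial>M) = \<sigma>2"
      unfolding X_def \<sigma>2_def by (rule D_integral) measurable
    have "(CLINT \<omega>|M. iexp (Z \<omega>)) = complex_of_real (\<integral>\<omega>. cos (Z \<omega>) \<partial>M) + \<i> * complex_of_real (\<integral>\<omega>. sin (Z \<omega>) \<partial>M)"
      using i1(2) by simp
    then have "(CLINT \<omega>|M. iexp (Z \<omega>) * complex_of_real ((X \<omega>)\<^sup>2)) - complex_of_real \<sigma>2 * (CLINT \<omega>|M. iexp (Z \<omega>))
      = complex_of_real (cov M (\<lambda>\<omega>. cos (Z \<omega>)) (\<lambda>\<omega>. (X \<omega>)\<^sup>2)) + \<i> * complex_of_real (cov M (\<lambda>\<omega>. sin (Z \<omega>)) (\<lambda>\<omega>. (X \<omega>)\<^sup>2))"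
      unfolding iX2(2) cov_def s by (simp add: algebra_simps)
    also have "cmod \<dots> \<le> \<bar>cov M (\<lambda>\<omega>. cos (Z \<omega>)) (\<lambda>\<omega>. (X \<omega>)\<^sup>2)\<bar> + \<bar>cov M (\<lambda>\<omega>. sin (Z \<omega>)) (\<lambda>\<omega>. (X \<omega>)\<^sup>2)\<bar>"
      by (rule order_trans[OF norm_triangle_ineq]) (simp add: norm_mult)
    also have "\<dots> \<le> 2 * d" using d[of cos] d[of sin] unfolding Z_def X_def by simp
    finally show ?thesis .
  qed
  define R where "R \<omega> = iexp (Z \<omega>) * (iexp (v * X \<omega>) - (1 + \<i> * complex_of_real (v * X \<omega>) - complex_of_real ((v * X \<omega>)\<^sup>2 / 2)))" for \<omega>
  define Q where "Q \<omega> = iexp (Z \<omega>) * complex_of_real 1 + (\<i> * complex_of_real v) * (iexp (Z \<omega>) * complex_of_real (X \<omega>))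
      - complex_of_real (v\<^sup>2 / 2) * (iexp (Z \<omega>) * complex_of_real ((X \<omega>)\<^sup>2))" for \<omega>
  have T_eq: "iexp (v * T (Suc r) \<omega>) = Q \<omega> + R \<omega>" for \<omega>
    by (simp add: T_Suc Q_def R_def Z_def X_def distrib_left exp_add power_mult_distrib algebra_simps)
  have iQ: "integrable M Q" unfolding Q_def[abs_def]
    using iX(1) iX2(1) i1(1) by (intro Bochner_Integration.integrable_add Bochner_Integration.integrable_diff integrable_mult_right)
  have iT: "integrable M (\<lambda>\<omega>. iexp (v * T (Suc r) \<omega>))" by (rule integrable_iexp_comp) measurable
  have iR: "integrable M R"
  proof -
    have "R = (\<lambda>\<omega>. iexp (v * T (Suc r) \<omega>) - Q \<omega>)" using T_eq by (auto simp: fun_eq_iff)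
    then show ?thesis using Bochner_Integration.integrable_diff[OF iT iQ] by simp
  qed
  have IQ: "(CLINT \<omega>|M. Q \<omega>) = (CLINT \<omega>|M. iexp (Z \<omega>)) - complex_of_real (v\<^sup>2 / 2) * (CLINT \<omega>|M. iexp (Z \<omega>) * complex_of_real ((X \<omega>)\<^sup>2))"
  proof -
    define a b c k l where "a \<omega> = iexp (Z \<omega>) * complex_of_real 1" and "b \<omega> = iexp (Z \<omega>) * complex_of_real (X \<omega>)"
      and "c \<omega> = iexp (Z \<omega>) * complex_of_real ((X \<omega>)\<^sup>2)"
      and "k = \<i> * complex_of_real v" and "l = complex_of_real (v\<^sup>2 / 2)" for \<omega>
    have i: "integrable M a" "integrable M b" "integrable M c"
      unfolding a_def b_def c_def by (rule i1(1) iX(1) iX2(1))+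
    then have "(CLINT \<omega>|M. a \<omega> + k * b \<omega> - l * c \<omega>) = (CLINT \<omega>|M. a \<omega>) + k * (CLINT \<omega>|M. b \<omega>) - l * (CLINT \<omega>|M. c \<omega>)"
      by simp
    moreover have "(CLINT \<omega>|M. b \<omega>) = 0" unfolding b_def by (rule D0)
    moreover have "(CLINT \<omega>|M. a \<omega>) = (CLINT \<omega>|M. iexp (Z \<omega>))" by (simp add: a_def)
    ultimately have "(CLINT \<omega>|M. a \<omega> + k * b \<omega> - l * c \<omega>) = (CLINT \<omega>|M. iexp (Z \<omega>)) - l * (CLINT \<omega>|M. c \<omega>)"
      by simp
    then show ?thesis unfolding Q_def a_def b_def c_def k_def l_def .
  qed
  have minX: "integrable M (\<lambda>\<omega>. min ((X \<omega>)\<^sup>2) (\<bar>v\<bar> * \<bar>X \<omega>\<bar> ^ 3))"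
    by (rule Bochner_Integration.integrable_bound[OF X2]) auto
  have "cmod (CLINT \<omega>|M. R \<omega>) \<le> (\<integral>\<omega>. cmod (R \<omega>) \<partial>M)" by (rule integral_norm_bound)
  also have "\<dots> \<le> (\<integral>\<omega>. v\<^sup>2 * min ((X \<omega>)\<^sup>2) (\<bar>v\<bar> * \<bar>X \<omega>\<bar> ^ 3) \<partial>M)"
  proof (rule integral_mono)
    show "cmod (R \<omega>) \<le> v\<^sup>2 * min ((X \<omega>)\<^sup>2) (\<bar>v\<bar> * \<bar>X \<omega>\<bar> ^ 3)" for \<omega>
      using norm_iexp_quadratic_remainder[of v "X \<omega>"] unfolding R_def norm_mult norm_exp_i_times by simp
  qed (use iR minX in \<open>auto intro: integrable_norm\<close>)
  also have "\<dots> = v\<^sup>2 * (\<integral>\<omega>. min ((X \<omega>)\<^sup>2) (\<bar>v\<bar> * \<bar>X \<omega>\<bar> ^ 3) \<partial>M)" by simp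
  also have "(\<integral>\<omega>. min ((X \<omega>)\<^sup>2) (\<bar>v\<bar> * \<bar>X \<omega>\<bar> ^ 3) \<partial>M) = (\<integral>\<omega>. min ((D 0 \<omega>)\<^sup>2) (\<bar>v\<bar> * \<bar>D 0 \<omega>\<bar> ^ 3) \<partial>M)"
    unfolding X_def by (rule D_integral) measurable
  finally have R: "cmod (CLINT \<omega>|M. R \<omega>) \<le> v\<^sup>2 * (\<integral>\<omega>. min ((D 0 \<omega>)\<^sup>2) (\<bar>v\<bar> * \<bar>D 0 \<omega>\<bar> ^ 3) \<partial>M)" .
  have "(CLINT \<omega>|M. iexp (v * T (Suc r) \<omega>)) - complex_of_real (1 - v\<^sup>2 * \<sigma>2 / 2) * (CLINT \<omega>|M. iexp (Z \<omega>))
    = (CLINT \<omega>|M. R \<omega>) - complex_of_real (v\<^sup>2 / 2) *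
      ((CLINT \<omega>|M. iexp (Z \<omega>) * complex_of_real ((X \<omega>)\<^sup>2)) - complex_of_real \<sigma>2 * (CLINT \<omega>|M. iexp (Z \<omega>)))"
    unfolding T_eq Bochner_Integration.integral_add[OF iQ iR] IQ by (simp add: algebra_simps)
  also have "cmod \<dots> \<le> cmod (CLINT \<omega>|M. R \<omega>) + cmod (complex_of_real (v\<^sup>2 / 2) *
      ((CLINT \<omega>|M. iexp (Z \<omega>) * complex_of_real ((X \<omega>)\<^sup>2)) - complex_of_real \<sigma>2 * (CLINT \<omega>|M. iexp (Z \<omega>))))"
    by (rule norm_triangle_ineq4)
  also have "cmod (complex_of_real (v\<^sup>2 / 2) *
      ((CLINT \<omega>|M. iexp (Z \<omega>) * complex_of_real ((X \<omega>)\<^sup>2)) - complex_of_real \<sigma>2 * (CLINT \<omega>|M. iexp (Z \<omega>)))) \<le> v\<^sup>2 / 2 * (2 * d)"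
    unfolding norm_mult norm_of_real using cov2 by (intro mult_mono) auto
  finally show ?thesis using R unfolding Z_def by (simp add: algebra_simps)
qed

text \<open>
  With \<open>v = u / \<surd>n\<close> the \<open>n\<close> errors of size \<open>o(v\<^sup>2)\<close> add up to \<open>o(1)\<close>, and the main terms give
  \<open>(1 - \<sigma>\<^sup>2 u\<^sup>2 / (2 n))\<^sup>n\<close>.
\<close>

theorem martingale_difference_clt:
  "(\<lambda>n. char (distr M borel (\<lambda>\<omega>. 1 / sqrt (real n) * T n \<omega>)) u) \<longlonglongrightarrow> exp (- (\<sigma>2 * u\<^sup>2 / 2))"
proof -
  define \<phi> where "\<phi> n = char (distr M borel (\<lambda>\<omega>. 1 / sqrt (real n) * T n \<omega>)) u" for n
  define v where "v n = u / sqrt (real n)" for n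
  define \<eta> where "\<eta> n = (\<integral>\<omega>. min ((D 0 \<omega>)\<^sup>2) (\<bar>v n\<bar> * \<bar>D 0 \<omega>\<bar> ^ 3) \<partial>M)" for n
  define p where "p n = (1 + (- (\<sigma>2 * u\<^sup>2 / 2)) / real n) ^ n" for n
  have D2: "integrable M (\<lambda>\<omega>. (D 0 \<omega>)\<^sup>2)"
    using D_square_integrable by (simp add: square_integrable_def)
  have v0: "v \<longlonglongrightarrow> 0" unfolding v_def
    by (intro tendsto_divide_0[OF tendsto_const] filterlim_at_top_imp_at_infinity
        filterlim_compose[OF sqrt_at_top filterlim_real_sequentially])
  have \<phi>_eq: "\<phi> n = (CLINT \<omega>|M. iexp (v n * T n \<omega>))" for n
    unfolding \<phi>_def v_def by (subst char_distr) (simp_all add: mult.assoc)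
  have "\<eta> \<longlonglongrightarrow> (\<integral>\<omega>. 0 \<partial>M)"
    unfolding \<eta>_def
  proof (rule integral_dominated_convergence[where w="\<lambda>\<omega>. (D 0 \<omega>)\<^sup>2"])
    show "AE \<omega> in M. (\<lambda>n. min ((D 0 \<omega>)\<^sup>2) (\<bar>v n\<bar> * \<bar>D 0 \<omega>\<bar> ^ 3)) \<longlonglongrightarrow> 0"
    proof (rule AE_I2)
      fix \<omega>
      have "(\<lambda>n. min ((D 0 \<omega>)\<^sup>2) (\<bar>v n\<bar> * \<bar>D 0 \<omega>\<bar> ^ 3)) \<longlonglongrightarrow> min ((D 0 \<omega>)\<^sup>2) (\<bar>0\<bar> * \<bar>D 0 \<omega>\<bar> ^ 3)"
        by (intro tendsto_intros v0)
      then show "(\<lambda>n. min ((D 0 \<omega>)\<^sup>2) (\<bar>v n\<bar> * \<bar>D 0 \<omega>\<bar> ^ 3)) \<longlonglongrightarrow> 0" by simp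
    qed
  qed (use D2 in auto)
  then have \<eta>0: "\<eta> \<longlonglongrightarrow> 0" by simp
  have "(\<lambda>n. \<phi> n - complex_of_real (p n)) \<longlonglongrightarrow> 0"
  proof (rule tendstoI)
    fix e :: real assume e: "0 < e"
    \<comment> \<open>The accumulated covariance error is \<open>u\<^sup>2 d < e\<close>; the summand \<open>1\<close> only avoids a division
      by zero at \<open>u = 0\<close>.\<close>
    define d where "d = e / (2 * (u\<^sup>2 + 1))"
    have u1: "0 < u\<^sup>2 + 1" by (simp add: add_nonneg_pos)
    have d: "0 < d" using e u1 by (simp add: d_def)
    obtain B where B: "\<And>c v r. c \<in> borel_measurable borel \<Longrightarrow> (\<And>x. \<bar>c x\<bar> \<le> 1) \<Longrightarrow> (\<And>x y. \<bar>c x - c y\<bar> \<le> \<bar>x - y\<bar>) \<Longrightarrow>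
      \<bar>cov M (\<lambda>\<omega>. c (v * T r \<omega>)) (\<lambda>\<omega>. (D (int r + 1) \<omega>)\<^sup>2)\<bar> \<le> d + B * \<bar>v\<bar>"
      using cov_square_le[OF d] by blast
    have trig: "\<bar>cov M (\<lambda>\<omega>. c (v * T r \<omega>)) (\<lambda>\<omega>. (D (int r + 1) \<omega>)\<^sup>2)\<bar> \<le> d + B * \<bar>v\<bar>"
      if "c = cos \<or> c = sin" for c :: "real \<Rightarrow> real" and v r
    proof (rule B)
      have "cmod (iexp x - iexp y) \<le> \<bar>x - y\<bar>" for x y by (rule norm_iexp_diff_le)
      then have "\<bar>Re (iexp x - iexp y)\<bar> \<le> \<bar>x - y\<bar>" "\<bar>Im (iexp x - iexp y)\<bar> \<le> \<bar>x - y\<bar>" for x y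
        using abs_Re_le_cmod abs_Im_le_cmod order_trans by blast+
      then show "\<bar>c x - c y\<bar> \<le> \<bar>x - y\<bar>" for x y
        using that by (auto simp: Re_exp Im_exp)
    qed (use that in auto)
    have "(\<lambda>n. u\<^sup>2 * (\<eta> n + (d + B * \<bar>v n\<bar>))) \<longlonglongrightarrow> u\<^sup>2 * (0 + (d + B * \<bar>0\<bar>))"
      by (intro tendsto_intros \<eta>0 v0)
    moreover have "u\<^sup>2 * (0 + (d + B * \<bar>0\<bar>)) < e"
    proof -
      have "u\<^sup>2 * d < (u\<^sup>2 + 1) * d" using d by simp
      also have "\<dots> = e / 2" using u1 by (simp add: d_def field_simps)
      finally show ?thesis using e by simp
    qed
    ultimately have "\<forall>\<^sub>F n in sequentially. u\<^sup>2 * (\<eta> n + (d + B * \<bar>v n\<bar>)) < e" by (rule order_tendstoD(2))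
    moreover have "\<forall>\<^sub>F n in sequentially. \<sigma>2 * u\<^sup>2 / 2 < real n"
      using filterlim_real_sequentially unfolding filterlim_at_top_dense by blast
    ultimately show "\<forall>\<^sub>F n in sequentially. dist (\<phi> n - complex_of_real (p n)) 0 < e"
      using eventually_gt_at_top[of 0]
    proof eventually_elim
      case (elim n)
      have v2: "(v n)\<^sup>2 = u\<^sup>2 / real n" by (simp add: v_def power_divide)
      have q: "1 - (v n)\<^sup>2 * \<sigma>2 / 2 = 1 + (- (\<sigma>2 * u\<^sup>2 / 2)) / real n"
        by (simp add: v2 mult.commute)
      have "\<bar>1 - (v n)\<^sup>2 * \<sigma>2 / 2\<bar> \<le> 1"
      proof -
        have "0 \<le> (v n)\<^sup>2 * \<sigma>2 / 2" using \<sigma>2_nonneg by simp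
        moreover have "(v n)\<^sup>2 * \<sigma>2 / 2 \<le> 1" using elim by (simp add: v2 field_simps)
        ultimately show ?thesis by simp
      qed
      then have "cmod ((CLINT \<omega>|M. iexp (v n * T n \<omega>)) - complex_of_real ((1 - (v n)\<^sup>2 * \<sigma>2 / 2) ^ n))
          \<le> real n * ((v n)\<^sup>2 * (\<eta> n + (d + B * \<bar>v n\<bar>)))"
        unfolding \<eta>_def using char_step[OF trig]
        by (intro power_recursion_error) (auto simp: T_def prob_space)
      also have "real n * ((v n)\<^sup>2 * (\<eta> n + (d + B * \<bar>v n\<bar>))) = u\<^sup>2 * (\<eta> n + (d + B * \<bar>v n\<bar>))"
        using elim by (simp add: v2)
      finally show ?case using elim unfolding \<phi>_eq p_def q by simp
    qed
  qed
  moreover have "p \<longlonglongrightarrow> exp (- (\<sigma>2 * u\<^sup>2 / 2))"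
    unfolding p_def by (rule tendsto_exp_limit_sequentially)
  then have "(\<lambda>n. complex_of_real (p n)) \<longlonglongrightarrow> complex_of_real (exp (- (\<sigma>2 * u\<^sup>2 / 2)))"
    by (rule tendsto_of_real)
  ultimately have "(\<lambda>n. (\<phi> n - complex_of_real (p n)) + complex_of_real (p n)) \<longlonglongrightarrow> 0 + complex_of_real (exp (- (\<sigma>2 * u\<^sup>2 / 2)))"
    by (rule tendsto_add)
  then show ?thesis by (simp add: \<phi>_def)
qed

end

section \<open>Stationary arrays\<close>

context past_process
begin

abbreviation joint_law :: "('a \<Rightarrow> real) \<Rightarrow> int \<Rightarrow> (real \<times> (nat \<Rightarrow> 's)) measure" where
  "joint_law X t \<equiv> distr M (borel \<Otimes>\<^sub>M past_space S) (\<lambda>\<omega>. (X \<omega>, past \<epsilon> t \<omega>))"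

lemma joint_law_integral:
  fixes f :: "real \<times> (nat \<Rightarrow> 's) \<Rightarrow> real"
  assumes [measurable]: "X \<in> borel_measurable M" "X' \<in> borel_measurable M"
    and law: "joint_law X' t' = joint_law X t"
    and f: "f \<in> borel_measurable (borel \<Otimes>\<^sub>M past_space S)"
  shows "(\<integral>\<omega>. f (X' \<omega>, past \<epsilon> t' \<omega>) \<partial>M) = (\<integral>\<omega>. f (X \<omega>, past \<epsilon> t \<omega>) \<partial>M)"
proof -
  have "(\<integral>\<omega>. f (X' \<omega>, past \<epsilon> t' \<omega>) \<partial>M) = integral\<^sup>L (joint_law X' t') f"
    by (rule integral_distr[symmetric, OF _ f]) measurable
  also have "\<dots> = (\<integral>\<omega>. f (X \<omega>, past \<epsilon> t \<omega>) \<partial>M)"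
    unfolding law by (rule integral_distr[OF _ f]) measurable
  finally show ?thesis .
qed

text \<open>
  A version \<open>g\<close> of the conditional expectation is determined by the joint law of the variable and
  the past, because the defining integrals over events of the past are.
\<close>

lemma E_law:
  assumes X: "square_integrable M X" and X': "square_integrable M X'"
    and law: "joint_law X' t' = joint_law X t"
    and g: "g \<in> borel_measurable (past_space S)" "AE \<omega> in M. E t X \<omega> = g (past \<epsilon> t \<omega>)"
  shows "AE \<omega> in M. E t' X' \<omega> = g (past \<epsilon> t' \<omega>)"
proof (rule cond.real_cond_exp_charact)
  have [measurable]: "X \<in> borel_measurable M" "X' \<in> borel_measurable M" "g \<in> borel_measurable (past_space S)"
    using X X' g by (auto simp: square_integrable_def)
  have "square_integrable M (\<lambda>\<omega>. g (past \<epsilon> t \<omega>))"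
    by (rule square_integrable_cong_AE[OF square_integrable_E[OF X] _ g(2)]) measurable
  then have "square_integrable M (\<lambda>\<omega>. g (past \<epsilon> t' \<omega>))"
    using past_law_square_integrable(1)[OF g(1)] by blast
  then show "integrable M (\<lambda>\<omega>. g (past \<epsilon> t' \<omega>))" by (rule square_integrable_integrable)
  show "integrable M X'" by (rule square_integrable_integrable[OF X'])
  show "(\<lambda>\<omega>. g (past \<epsilon> t' \<omega>)) \<in> borel_measurable (F t')" by (rule measurable_F_past) (use g in auto)
  fix A assume "A \<in> sets (F t')"
  then obtain B where B[measurable]: "B \<in> sets (past_space S)" and A: "A = past \<epsilon> t' -` B \<inter> space M"
    by (auto simp: sets_F)
  define A0 where "A0 = past \<epsilon> t -` B \<inter> space M"
  have A0: "A0 \<in> sets (F t)" using B by (auto simp: sets_F A0_def)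
  have [measurable]: "A0 \<in> sets M" using A0 subalgebra_M_F by (auto simp: subalgebra_def)
  have "(\<integral>\<omega>\<in>A. X' \<omega> \<partial>M) = (\<integral>\<omega>. indicator B (past \<epsilon> t' \<omega>) * X' \<omega> \<partial>M)"
    unfolding set_lebesgue_integral_def
    by (intro Bochner_Integration.integral_cong) (auto simp: A indicator_def)
  also have "\<dots> = (\<integral>\<omega>. indicator B (past \<epsilon> t \<omega>) * X \<omega> \<partial>M)"
    using joint_law_integral[OF _ _ law, of "\<lambda>(x, z). indicator B z * x"] by simp
  also have "\<dots> = (\<integral>\<omega>\<in>A0. X \<omega> \<partial>M)"
    unfolding set_lebesgue_integral_def
    by (intro Bochner_Integration.integral_cong) (auto simp: A0_def indicator_def)
  also have "\<dots> = (\<integral>\<omega>\<in>A0. E t X \<omega> \<partial>M)"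
    by (rule cond.real_cond_exp_intA[OF square_integrable_integrable[OF X] A0])
  also have "\<dots> = (\<integral>\<omega>. indicator B (past \<epsilon> t \<omega>) * g (past \<epsilon> t \<omega>) \<partial>M)"
    unfolding set_lebesgue_integral_def using g(2)
    by (intro integral_cong_AE) (auto simp: A0_def indicator_def)
  also have "\<dots> = (\<integral>\<omega>. indicator B (past \<epsilon> t' \<omega>) * g (past \<epsilon> t' \<omega>) \<partial>M)"
    by (rule past_law_integral(1)[of "\<lambda>z. indicator B z * g z"]) measurable
  also have "\<dots> = (\<integral>\<omega>\<in>A. g (past \<epsilon> t' \<omega>) \<partial>M)"
    unfolding set_lebesgue_integral_def
    by (intro Bochner_Integration.integral_cong) (auto simp: A indicator_def)
  finally show "(\<integral>\<omega>\<in>A. X' \<omega> \<partial>M) = (\<integral>\<omega>\<in>A. g (past \<epsilon> t' \<omega>) \<partial>M)" .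
qed

end

text \<open>
  In the application the weights are absorbed into \<open>X\<close>.
\<close>

locale stationary_array = past_process M S \<epsilon>
  for M :: "'a measure" and S :: "'s measure" and \<epsilon> :: "int \<Rightarrow> 'a \<Rightarrow> 's" +
  fixes X :: "int \<Rightarrow> int \<Rightarrow> 'a \<Rightarrow> real"
  assumes X_measurable_F: "X i j \<in> borel_measurable (F (max i j))"
    and X_square_integrable: "square_integrable M (X i j)"
    and X_mean: "(\<integral>\<omega>. X i j \<omega> \<partial>M) = 0"
    and X_law: "joint_law (X (i + t) (j + t)) (k + t) = joint_law (X i j) k"
    and X_summable: "(\<lambda>(i, j). l2_norm M (P 0 (X i j))) summable_on UNIV"
begin

definition \<alpha> :: "int \<times> int \<Rightarrow> real" where
  "\<alpha> = (\<lambda>(i, j). l2_norm M (P 0 (X i j)))"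

definition total :: real where "total = infsum \<alpha> UNIV"

lemma \<alpha>_nonneg [simp]: "0 \<le> \<alpha> x"
  by (simp add: \<alpha>_def split: prod.split)

lemma \<alpha>_sum_le: "finite K \<Longrightarrow> sum \<alpha> K \<le> total"
  unfolding total_def using X_summable by (intro finite_sum_le_infsum) (auto simp: \<alpha>_def)

lemma total_nonneg: "0 \<le> total"
  using \<alpha>_sum_le[of "{}"] by simp

definition window :: "nat \<Rightarrow> (int \<times> int) set" where
  "window N = {- int N..int N} \<times> {- int N..int N}"

lemma finite_window [simp]: "finite (window N)"
  by (simp add: window_def)

text \<open>
  A window that contains a finite set carrying all but \<open>d\<close> of the total leaves at most \<open>d\<close> to
  every finite set outside it.
\<close>

lemma \<alpha>_tail:
  assumes d: "0 < d"
  shows "\<exists>N. \<forall>K. finite K \<longrightarrow> K \<inter> window N = {} \<longrightarrow> sum \<alpha> K \<le> d"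
proof -
  have "(\<alpha> has_sum total) UNIV"
    unfolding total_def using X_summable by (intro has_sum_infsum) (simp add: \<alpha>_def)
  then have "(sum \<alpha> \<longlongrightarrow> total) (finite_subsets_at_top UNIV)" by (simp add: has_sum_def)
  then have "\<forall>\<^sub>F K in finite_subsets_at_top UNIV. total - d < sum \<alpha> K"
    using d by (intro order_tendstoD(1)) auto
  then obtain K0 where K0: "finite K0" "total - d < sum \<alpha> K0"
    unfolding eventually_finite_subsets_at_top by blast
  define N where "N = nat (Max (insert 0 ((\<lambda>(i, j). max \<bar>i\<bar> \<bar>j\<bar>) ` K0)))"
  have "max \<bar>i\<bar> \<bar>j\<bar> \<le> int N" if "(i, j) \<in> K0" for i j
  proof -
    have "max \<bar>i\<bar> \<bar>j\<bar> \<le> Max (insert 0 ((\<lambda>(i, j). max \<bar>i\<bar> \<bar>j\<bar>) ` K0))"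
      using K0(1) that by (intro Max_ge) (auto intro: image_eqI[of _ _ "(i, j)"])
    then show ?thesis unfolding N_def by linarith
  qed
  then have "K0 \<subseteq> window N" unfolding window_def by fastforce
  have "sum \<alpha> K \<le> d" if K: "finite K" "K \<inter> window N = {}" for K
  proof -
    have "sum \<alpha> K + sum \<alpha> K0 = sum \<alpha> (K \<union> K0)"
      using K K0 \<open>K0 \<subseteq> window N\<close> by (intro sum.union_disjoint[symmetric]) auto
    also have "\<dots> \<le> total" using K K0 by (intro \<alpha>_sum_le) auto
    finally show ?thesis using K0 by simp
  qed
  then show ?thesis by blast
qed

text \<open>
  The projection at time \<open>t\<close> is a difference of two conditional expectations, at lags \<open>0\<close> and
  \<open>-1\<close> relative to \<open>t\<close>; the earlier past is the shift of the later one, so that the difference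
  is one function of the past at time \<open>t\<close>.
\<close>

lemma P_stationary:
  "\<exists>h. h \<in> borel_measurable (past_space S) \<and> (\<forall>t. AE \<omega> in M. P t (X (a + t) (b + t)) \<omega> = h (past \<epsilon> t \<omega>))"
proof -
  have "\<exists>g. g \<in> borel_measurable (past_space S) \<and> (\<forall>t. AE \<omega> in M. E (k + t) (X (a + t) (b + t)) \<omega> = g (past \<epsilon> (k + t) \<omega>))" for k
  proof -
    obtain g where g: "g \<in> borel_measurable (past_space S)"
      "\<And>\<omega>. \<omega> \<in> space M \<Longrightarrow> E k (X a b) \<omega> = g (past \<epsilon> k \<omega>)"
      using measurable_F_factor[OF borel_measurable_cond_exp] by blast
    have "AE \<omega> in M. E (k + t) (X (a + t) (b + t)) \<omega> = g (past \<epsilon> (k + t) \<omega>)" for t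
      using g by (intro E_law[OF X_square_integrable X_square_integrable X_law[of a t b k]]) auto
    with g show ?thesis by blast
  qed
  from this[of 0] this[of "-1"] obtain g0 g1 where
    g0: "g0 \<in> borel_measurable (past_space S)" "\<And>t. AE \<omega> in M. E t (X (a + t) (b + t)) \<omega> = g0 (past \<epsilon> t \<omega>)" and
    g1: "g1 \<in> borel_measurable (past_space S)" "\<And>t. AE \<omega> in M. E (t - 1) (X (a + t) (b + t)) \<omega> = g1 (past \<epsilon> (t - 1) \<omega>)"
    by auto
  have "AE \<omega> in M. P t (X (a + t) (b + t)) \<omega> = g0 (past \<epsilon> t \<omega>) - g1 (shift 1 (past \<epsilon> t \<omega>))" for t
    using g0(2)[of t] g1(2)[of t] past_eq_shift[of "t - 1" t] by (auto simp: projection_def)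
  moreover have "(\<lambda>x. g0 x - g1 (shift 1 x)) \<in> borel_measurable (past_space S)"
    using g0(1) g1(1) by measurable
  ultimately show ?thesis by (intro exI[of _ "\<lambda>x. g0 x - g1 (shift 1 x)"]) simp
qed

definition kernel :: "int \<times> int \<Rightarrow> (nat \<Rightarrow> 's) \<Rightarrow> real" where
  "kernel = (\<lambda>(a, b). SOME h. h \<in> borel_measurable (past_space S) \<and>
     (\<forall>t. AE \<omega> in M. P t (X (a + t) (b + t)) \<omega> = h (past \<epsilon> t \<omega>)))"

lemma kernel_measurable [measurable]: "kernel x \<in> borel_measurable (past_space S)"
  and P_eq_kernel: "AE \<omega> in M. P t (X (fst x + t) (snd x + t)) \<omega> = kernel x (past \<epsilon> t \<omega>)"
  using someI_ex[OF P_stationary[of "fst x" "snd x"]] by (auto simp: kernel_def split: prod.split)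

lemma P_X_square_integrable: "square_integrable M (P t (X i j))"
  by (intro square_integrable_P X_square_integrable)

lemma l2_norm_P_X: "l2_norm M (P t (X i j)) = \<alpha> (i - t, j - t)"
proof -
  have *: "l2_norm M (P s (X (a + s) (b + s))) = l2_norm M (\<lambda>\<omega>. kernel (a, b) (past \<epsilon> s \<omega>))" for a b s
    using P_eq_kernel[of s "(a, b)"] square_integrable_measurable[OF P_X_square_integrable[of s "a + s" "b + s"]]
    by (intro l2_norm_cong_AE) auto
  show ?thesis
    using *[of t "i - t" "j - t"] *[of 0 "i - t" "j - t"]
      past_law_square_integrable(2)[of "kernel (i - t, j - t)" t 0]
    by (simp add: \<alpha>_def)
qed

definition partial_sum :: "nat \<Rightarrow> 'a \<Rightarrow> real" where
  "partial_sum n \<omega> = (\<Sum>x\<in>{1..int n} \<times> {1..int n}. X (fst x) (snd x) \<omega>)"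

lemma partial_sum_square_integrable: "square_integrable M (partial_sum n)"
  unfolding partial_sum_def[abs_def] by (intro square_integrable_sum X_square_integrable)

lemma l2_norm_sum_P_X_le:
  "l2_norm M (\<lambda>\<omega>. \<Sum>x\<in>K. P t (X (fst x) (snd x)) \<omega>) \<le> (\<Sum>x\<in>K. \<alpha> (fst x - t, snd x - t))"
  using l2_norm_sum[of K M "\<lambda>x. P t (X (fst x) (snd x))"] P_X_square_integrable
  by (simp add: l2_norm_P_X)

lemma sum_\<alpha>_shift: "(\<Sum>x\<in>K. \<alpha> (fst x - t, snd x - t)) = sum \<alpha> ((\<lambda>x. (fst x - t, snd x - t)) ` K)"
  by (subst sum.reindex) (auto simp: inj_on_def)

context
  fixes N :: nat
begin

text \<open>
  The martingale difference at time \<open>t\<close> collects the projections at \<open>t\<close> of all entries whose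
  offset from \<open>(t, t)\<close> lies in the window.
\<close>

definition truncated_kernel :: "(nat \<Rightarrow> 's) \<Rightarrow> real" where
  "truncated_kernel x = (\<Sum>a\<in>window N. kernel a x)"

lemma truncated_kernel_eq: "AE \<omega> in M. truncated_kernel (past \<epsilon> t \<omega>) = (\<Sum>a\<in>window N. P t (X (fst a + t) (snd a + t)) \<omega>)"
proof -
  have "AE \<omega> in M. \<forall>a\<in>window N. P t (X (fst a + t) (snd a + t)) \<omega> = kernel a (past \<epsilon> t \<omega>)"
    by (intro AE_finite_allI finite_window P_eq_kernel)
  then show ?thesis by eventually_elim (simp add: truncated_kernel_def)
qed

lemma truncated_kernel_martingale_difference: "past_martingale_difference M S \<epsilon> truncated_kernel"
proof
  have [measurable]: "truncated_kernel \<in> borel_measurable (past_space S)" unfolding truncated_kernel_def[abs_def] by measurable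
  then show "truncated_kernel \<in> borel_measurable (past_space S)" .
  have sq: "square_integrable M (\<lambda>\<omega>. \<Sum>a\<in>window N. P t (X (fst a + t) (snd a + t)) \<omega>)" for t
    by (intro square_integrable_sum P_X_square_integrable)
  then have [measurable]: "(\<lambda>\<omega>. \<Sum>a\<in>window N. P t (X (fst a + t) (snd a + t)) \<omega>) \<in> borel_measurable M" for t
    by (rule square_integrable_measurable)
  show "square_integrable M (\<lambda>\<omega>. truncated_kernel (past \<epsilon> 0 \<omega>))"
    using truncated_kernel_eq[of 0] by (intro square_integrable_cong_AE[OF sq[of 0]]) auto
  show "AE \<omega> in M. E (t - 1) (\<lambda>\<omega>. truncated_kernel (past \<epsilon> t \<omega>)) \<omega> = 0" for t
  proof -
    have "AE \<omega> in M. E (t - 1) (\<lambda>\<omega>. truncated_kernel (past \<epsilon> t \<omega>)) \<omega>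
        = E (t - 1) (\<lambda>\<omega>. \<Sum>a\<in>window N. P t (X (fst a + t) (snd a + t)) \<omega>) \<omega>"
      using truncated_kernel_eq[of t] by (intro cond.real_cond_exp_cong) auto
    moreover have "AE \<omega> in M. E (t - 1) (\<lambda>\<omega>. \<Sum>a\<in>window N. P t (X (fst a + t) (snd a + t)) \<omega>) \<omega>
        = (\<Sum>a\<in>window N. E (t - 1) (P t (X (fst a + t) (snd a + t))) \<omega>)"
      by (intro cond.real_cond_exp_sum square_integrable_integrable P_X_square_integrable)
    moreover have "AE \<omega> in M. \<forall>a\<in>window N. E (t - 1) (P t (X (fst a + t) (snd a + t))) \<omega> = 0"
      by (intro AE_finite_allI finite_window E_P_eq_0 X_square_integrable)
    ultimately show ?thesis by eventually_elim simp
  qed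
qed

interpretation MD: past_martingale_difference M S \<epsilon> truncated_kernel
  by (rule truncated_kernel_martingale_difference)

definition remainder :: "nat \<Rightarrow> 'a \<Rightarrow> real" where
  "remainder n \<omega> = partial_sum n \<omega> - MD.T n \<omega>"

lemma remainder_square_integrable: "square_integrable M (remainder n)"
  unfolding remainder_def[abs_def]
  by (intro square_integrable_diff partial_sum_square_integrable MD.T_square_integrable)

lemma remainder_measurable_F: "remainder n \<in> borel_measurable (F (int n))"
  unfolding remainder_def[abs_def] partial_sum_def[abs_def]
  by (intro borel_measurable_diff borel_measurable_sum MD.T_measurable_F measurable_F_mono[OF X_measurable_F])
     auto

lemma remainder_mean: "(\<integral>\<omega>. remainder n \<omega> \<partial>M) = 0"
proof -
  have "(\<integral>\<omega>. MD.D t \<omega> \<partial>M) = 0" for t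
  proof -
    have "(\<integral>\<omega>. MD.D t \<omega> \<partial>M) = (\<integral>\<omega>. E (t - 1) (MD.D t) \<omega> \<partial>M)"
      by (intro cond.real_cond_exp_int(2)[symmetric] square_integrable_integrable MD.D_square_integrable)
    also have "\<dots> = (\<integral>\<omega>. 0 \<partial>M)"
      using MD.martingale_difference[of t] by (intro integral_cong_AE) (auto simp: MD.D_def[abs_def])
    finally show ?thesis by simp
  qed
  then show ?thesis
    unfolding remainder_def[abs_def] partial_sum_def[abs_def] MD.T_def[abs_def]
    using square_integrable_integrable[OF X_square_integrable] square_integrable_integrable[OF MD.D_square_integrable]
    by (simp add: X_mean)
qed

lemma P_remainder:
  "AE \<omega> in M. P t (remainder n) \<omega> = (\<Sum>x\<in>{1..int n} \<times> {1..int n}. P t (X (fst x) (snd x)) \<omega>) -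
     (if t \<in> {1..int n} then \<Sum>a\<in>window N. P t (X (fst a + t) (snd a + t)) \<omega> else 0)"
proof -
  have "AE \<omega> in M. P t (remainder n) \<omega> = P t (partial_sum n) \<omega> - P t (MD.T n) \<omega>"
    unfolding remainder_def[abs_def] by (intro P_diff partial_sum_square_integrable MD.T_square_integrable)
  moreover have "AE \<omega> in M. P t (partial_sum n) \<omega> = (\<Sum>x\<in>{1..int n} \<times> {1..int n}. P t (X (fst x) (snd x)) \<omega>)"
    unfolding partial_sum_def[abs_def] by (intro P_sum X_square_integrable)
  moreover have "AE \<omega> in M. P t (MD.T n) \<omega> = (\<Sum>s\<in>{1..int n}. P t (MD.D s) \<omega>)"
    unfolding MD.T_def[abs_def] by (intro P_sum MD.D_square_integrable)
  moreover have "AE \<omega> in M. \<forall>s\<in>{1..int n}. P t (MD.D s) \<omega> = (if t = s then MD.D s \<omega> else 0)"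
    using MD.martingale_difference MD.D_measurable_F MD.D_square_integrable
    by (intro AE_finite_allI finite_atLeastAtMost_int P_martingale_difference) (auto simp: MD.D_def[abs_def])
  moreover have "AE \<omega> in M. MD.D t \<omega> = (\<Sum>a\<in>window N. P t (X (fst a + t) (snd a + t)) \<omega>)"
    unfolding MD.D_def by (rule truncated_kernel_eq)
  ultimately show ?thesis
    by eventually_elim simp
qed

text \<open>
  Relative to \<open>(t, t)\<close> the partial sum contributes the offsets in a translated square \<open>K\<close> and the
  martingale difference those in the window; offsets common to both cancel.
\<close>

lemma l2_norm_P_remainder_le:
  assumes t: "t \<in> {1..int n}"
  defines "K \<equiv> (\<lambda>x. (fst x - t, snd x - t)) ` ({1..int n} \<times> {1..int n})"
  shows "l2_norm M (P t (remainder n)) \<le> sum \<alpha> ((K - window N) \<union> (window N - K))"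
proof -
  define f where "f a = P t (X (fst a + t) (snd a + t))" for a
  have f: "square_integrable M (f a)" for a unfolding f_def by (rule P_X_square_integrable)
  have fK: "finite K" by (simp add: K_def)
  have "(\<Sum>x\<in>{1..int n} \<times> {1..int n}. P t (X (fst x) (snd x)) \<omega>) = (\<Sum>a\<in>K. f a \<omega>)" for \<omega>
    unfolding K_def f_def by (subst sum.reindex) (auto simp: inj_on_def)
  then have "AE \<omega> in M. P t (remainder n) \<omega> = (\<Sum>a\<in>K. f a \<omega>) - (\<Sum>a\<in>window N. f a \<omega>)"
    using P_remainder[of t n] t by (simp add: f_def)
  moreover have "(\<Sum>a\<in>K. f a \<omega>) - (\<Sum>a\<in>window N. f a \<omega>) = (\<Sum>a\<in>K - window N. f a \<omega>) - (\<Sum>a\<in>window N - K. f a \<omega>)" for \<omega>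
    using sum.Int_Diff[of K "\<lambda>a. f a \<omega>" "window N"] sum.Int_Diff[of "window N" "\<lambda>a. f a \<omega>" K] fK
    by (simp add: Int_commute)
  ultimately have "l2_norm M (P t (remainder n)) = l2_norm M (\<lambda>\<omega>. (\<Sum>a\<in>K - window N. f a \<omega>) - (\<Sum>a\<in>window N - K. f a \<omega>))"
    using square_integrable_diff[OF square_integrable_sum[of "K - window N" M f, OF f]
        square_integrable_sum[of "window N - K" M f, OF f]]
      square_integrable_P[OF remainder_square_integrable, of t n]
    by (intro l2_norm_cong_AE square_integrable_measurable) auto
  also have "\<dots> \<le> l2_norm M (\<lambda>\<omega>. \<Sum>a\<in>K - window N. f a \<omega>) + l2_norm M (\<lambda>\<omega>. \<Sum>a\<in>window N - K. f a \<omega>)"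
    by (intro l2_norm_diff square_integrable_sum f)
  also have "\<dots> \<le> (\<Sum>a\<in>K - window N. l2_norm M (f a)) + (\<Sum>a\<in>window N - K. l2_norm M (f a))"
    by (intro add_mono l2_norm_sum f)
  also have "\<dots> = sum \<alpha> (K - window N) + sum \<alpha> (window N - K)"
    by (simp add: f_def l2_norm_P_X)
  also have "\<dots> = sum \<alpha> ((K - window N) \<union> (window N - K))"
    using fK by (intro sum.union_disjoint[symmetric]) auto
  finally show ?thesis .
qed

lemma l2_norm_P_remainder_nonpos_le:
  assumes t: "t \<le> 0"
  shows "l2_norm M (P t (remainder n)) \<le> (\<Sum>x\<in>{1..int n} \<times> {1..int n}. \<alpha> (fst x - t, snd x - t))"
proof -
  have "l2_norm M (P t (remainder n)) = l2_norm M (\<lambda>\<omega>. \<Sum>x\<in>{1..int n} \<times> {1..int n}. P t (X (fst x) (snd x)) \<omega>)"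
    using P_remainder[of t n] t square_integrable_P[OF remainder_square_integrable, of t n]
      square_integrable_sum[of "{1..int n} \<times> {1..int n}" M "\<lambda>x. P t (X (fst x) (snd x))", OF P_X_square_integrable]
    by (intro l2_norm_cong_AE square_integrable_measurable) auto
  then show ?thesis using l2_norm_sum_P_X_le by simp
qed

text \<open>
  Four ranges of times occur. Away from both ends of \<open>1..n\<close> the square contains the window and
  the projection has norm at most \<open>d\<close>. Within distance \<open>N\<close> of \<open>0\<close> and just before \<open>n\<close>, which
  are at most \<open>3 N\<close> times, it is bounded by the total. Far before \<open>0\<close> the square misses the window,
  so that the square of the norm is at most \<open>d\<close> times the sum of \<open>\<alpha>\<close> over the translated square;
  these sums add up over all times to at most \<open>n\<close> times the total, since for a fixed row \<open>i\<close> the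
  offsets \<open>(i - t, j - t)\<close> are distinct.
\<close>

lemma remainder_second_moment_le:
  assumes tail: "\<And>K. finite K \<Longrightarrow> K \<inter> window N = {} \<Longrightarrow> sum \<alpha> K \<le> d" and d: "0 \<le> d"
  shows "(l2_norm M (remainder n))\<^sup>2 \<le> real n * (d\<^sup>2 + d * total) + 3 * real N * total\<^sup>2"
proof (rule second_moment_le_projections[OF remainder_measurable_F remainder_square_integrable remainder_mean])
  fix L
  define b where "b t = (l2_norm M (P t (remainder n)))\<^sup>2" for t
  define \<rho> where "\<rho> t = (\<Sum>x\<in>{1..int n} \<times> {1..int n}. \<alpha> (fst x - t, snd x - t))" for t
  define U where "U = {int n - int L<..int n}"
  have \<rho>0: "0 \<le> \<rho> t" for t by (simp add: \<rho>_def sum_nonneg)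
  have \<rho>_le: "\<rho> t \<le> total" for t unfolding \<rho>_def sum_\<alpha>_shift by (rule \<alpha>_sum_le) simp
  define I where "I = {- int N<..int N} \<union> {int n - int N<..int n}"
  have b_le: "b t \<le> (if t \<in> {1..int n} then d\<^sup>2 else 0) + (if t \<in> I then total\<^sup>2 else 0) + (if t \<le> 0 then d * \<rho> t else 0)"
    if "t \<in> U" for t
  proof -
    have tn: "t \<le> int n" using that by (simp add: U_def)
    consider (int) "t \<in> {1..int n}" "t \<in> I" | (inner) "t \<in> {1..int n}" "t \<notin> I" | (near) "t \<le> 0" "t \<in> I" | (far) "t \<le> 0" "t \<notin> I"
      using tn by fastforce
    then show ?thesis
    proof cases
      case int
      have "l2_norm M (P t (remainder n)) \<le> total"
        using l2_norm_P_remainder_le[OF int(1)] by (rule order_trans) (intro \<alpha>_sum_le, simp)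
      then have "b t \<le> total\<^sup>2" unfolding b_def by (intro power_mono) auto
      then show ?thesis using int by (simp add: add_increasing)
    next
      case inner
      define K where "K = (\<lambda>x. (fst x - t, snd x - t)) ` ({1..int n} \<times> {1..int n})"
      have K: "window N \<subseteq> K"
      proof
        fix a assume a: "a \<in> window N"
        have "a = (\<lambda>x. (fst x - t, snd x - t)) (fst a + t, snd a + t)" by simp
        moreover have "(fst a + t, snd a + t) \<in> {1..int n} \<times> {1..int n}"
          using a inner by (auto simp: window_def I_def)
        ultimately show "a \<in> K" unfolding K_def by (rule image_eqI)
      qed
      have "l2_norm M (P t (remainder n)) \<le> sum \<alpha> ((K - window N) \<union> (window N - K))"
        using l2_norm_P_remainder_le[OF inner(1)] unfolding K_def .
      also have "\<dots> \<le> d" using K by (intro tail) (auto simp: K_def)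
      finally have "b t \<le> d\<^sup>2" unfolding b_def by (intro power_mono) auto
      then show ?thesis using inner by simp
    next
      case near
      have "l2_norm M (P t (remainder n)) \<le> total"
        using l2_norm_P_remainder_nonpos_le[OF near(1), of n, folded \<rho>_def] \<rho>_le[of t] by (rule order_trans)
      then have "b t \<le> total\<^sup>2" unfolding b_def by (intro power_mono) auto
      moreover have "0 \<le> d * \<rho> t" using d \<rho>0 by (rule mult_nonneg_nonneg)
      ultimately show ?thesis using near by simp
    next
      case far
      have "\<rho> t \<le> d"
        unfolding \<rho>_def sum_\<alpha>_shift
      proof (rule tail)
        show "(\<lambda>x. (fst x - t, snd x - t)) ` ({1..int n} \<times> {1..int n}) \<inter> window N = {}"
          using far by (auto simp: window_def I_def)
      qed simp
      have "b t \<le> (\<rho> t)\<^sup>2"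
        unfolding b_def using l2_norm_P_remainder_nonpos_le[OF far(1), of n, folded \<rho>_def]
        by (intro power_mono) auto
      also have "\<dots> \<le> d * \<rho> t"
        unfolding power2_eq_square using \<open>\<rho> t \<le> d\<close> \<rho>0 by (intro mult_right_mono) auto
      finally show ?thesis using far by simp
    qed
  qed
  have fU: "finite U" by (simp add: U_def)
  have s1: "(\<Sum>t\<in>U. if t \<in> {1..int n} then d\<^sup>2 else 0) \<le> real n * d\<^sup>2"
  proof -
    have "(\<Sum>t\<in>U. if t \<in> {1..int n} then d\<^sup>2 else 0) = (\<Sum>t\<in>U \<inter> {1..int n}. d\<^sup>2)"
      by (rule sum.inter_restrict[OF fU, symmetric])
    also have "\<dots> \<le> (\<Sum>t\<in>{1..int n}. d\<^sup>2)" by (intro sum_mono2) auto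
    finally show ?thesis by simp
  qed
  have s2: "(\<Sum>t\<in>U. if t \<in> I then total\<^sup>2 else 0) \<le> 3 * real N * total\<^sup>2"
  proof -
    have "(\<Sum>t\<in>U. if t \<in> I then total\<^sup>2 else 0) = (\<Sum>t\<in>U \<inter> I. total\<^sup>2)"
      by (rule sum.inter_restrict[OF fU, symmetric])
    also have "\<dots> \<le> (\<Sum>t\<in>I. total\<^sup>2)" by (intro sum_mono2) (auto simp: I_def)
    also have "\<dots> = real (card I) * total\<^sup>2" by simp
    also have "real (card I) \<le> 3 * real N"
      using card_Un_le[of "{- int N<..int N}" "{int n - int N<..int n}"] by (simp add: I_def)
    finally show ?thesis by (simp add: mult_right_mono)
  qed
  have s3: "(\<Sum>t\<in>U. if t \<le> 0 then d * \<rho> t else 0) \<le> d * (real n * total)"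
  proof -
    have "(\<Sum>t\<in>U. if t \<le> 0 then d * \<rho> t else 0) \<le> (\<Sum>t\<in>U. d * \<rho> t)"
      using d \<rho>0 by (intro sum_mono) auto
    also have "\<dots> = d * (\<Sum>t\<in>U. \<rho> t)" by (simp add: sum_distrib_left)
    also have "(\<Sum>t\<in>U. \<rho> t) = (\<Sum>t\<in>U. \<Sum>i\<in>{1..int n}. \<Sum>j\<in>{1..int n}. \<alpha> (i - t, j - t))"
      unfolding \<rho>_def by (simp add: sum.cartesian_product split_def)
    also have "\<dots> = (\<Sum>i\<in>{1..int n}. \<Sum>t\<in>U. \<Sum>j\<in>{1..int n}. \<alpha> (i - t, j - t))"
      by (rule sum.swap)
    also have "\<dots> \<le> (\<Sum>i\<in>{1..int n}. total)"
    proof (rule sum_mono)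
      fix i
      have "(\<Sum>t\<in>U. \<Sum>j\<in>{1..int n}. \<alpha> (i - t, j - t)) = (\<Sum>x\<in>U \<times> {1..int n}. \<alpha> (i - fst x, snd x - fst x))"
        by (simp add: sum.cartesian_product split_def)
      also have "\<dots> = sum \<alpha> ((\<lambda>x. (i - fst x, snd x - fst x)) ` (U \<times> {1..int n}))"
        by (subst sum.reindex) (auto simp: inj_on_def)
      also have "\<dots> \<le> total" using fU by (intro \<alpha>_sum_le) simp
      finally show "(\<Sum>t\<in>U. \<Sum>j\<in>{1..int n}. \<alpha> (i - t, j - t)) \<le> total" .
    qed
    also have "\<dots> = real n * total" by simp
    finally show ?thesis using d by (simp add: mult_left_mono)
  qed
  have "(\<Sum>t\<in>U. b t) \<le> (\<Sum>t\<in>U. (if t \<in> {1..int n} then d\<^sup>2 else 0) + (if t \<in> I then total\<^sup>2 else 0) + (if t \<le> 0 then d * \<rho> t else 0))"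
    by (intro sum_mono b_le)
  also have "\<dots> \<le> real n * d\<^sup>2 + 3 * real N * total\<^sup>2 + d * (real n * total)"
    unfolding sum.distrib by (intro add_mono s1 s2 s3)
  finally show "(\<Sum>t\<in>{int n - int L<..int n}. (l2_norm M (P t (remainder n)))\<^sup>2) \<le> real n * (d\<^sup>2 + d * total) + 3 * real N * total\<^sup>2"
    unfolding U_def b_def by (simp add: algebra_simps)
qed

end

text \<open>
  The constants are chosen so that \<open>d\<^sup>2 + d\<close> times the total is at most \<open>e\<^sup>2 / 2\<close>, and the boundary
  term of order \<open>1 / n\<close> is at most \<open>e\<^sup>2 / 2\<close> for large \<open>n\<close>.
\<close>

theorem partial_sum_clt:
  "\<exists>v\<ge>0. weak_conv_m (\<lambda>n. distr M borel (\<lambda>\<omega>. 1 / sqrt (real n) * partial_sum n \<omega>)) (normal_law 0 v)"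
proof (rule normal_limit_by_approximation)
  show "square_integrable M (\<lambda>\<omega>. 1 / sqrt (real n) * partial_sum n \<omega>)" for n
    by (intro square_integrable_cmult partial_sum_square_integrable)
  fix e :: real assume e: "0 < e"
  define d where "d = min 1 (e\<^sup>2 / (2 * (1 + total)))"
  have A1: "0 < 1 + total" using total_nonneg by simp
  have d: "0 < d" "d \<le> 1" using e A1 by (auto simp: d_def)
  have "d * (1 + total) \<le> e\<^sup>2 / (2 * (1 + total)) * (1 + total)"
    using A1 by (intro mult_right_mono) (auto simp: d_def)
  also have "\<dots> = e\<^sup>2 / 2" using A1 by (simp add: field_simps)
  finally have dA: "d * (1 + total) \<le> e\<^sup>2 / 2" .
  have "d\<^sup>2 \<le> d * 1" unfolding power2_eq_square using d by (intro mult_left_mono) auto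
  with dA have dA: "d\<^sup>2 + d * total \<le> e\<^sup>2 / 2" by (simp add: algebra_simps)
  obtain N where tail: "\<And>K. finite K \<Longrightarrow> K \<inter> window N = {} \<Longrightarrow> sum \<alpha> K \<le> d"
    using \<alpha>_tail[OF d(1)] by blast
  interpret MD: past_martingale_difference M S \<epsilon> "truncated_kernel N" by (rule truncated_kernel_martingale_difference)
  obtain n0 where n0: "6 * real N * total\<^sup>2 / e\<^sup>2 < real n0" using reals_Archimedean2 by blast
  have close: "l2_norm M (\<lambda>\<omega>. 1 / sqrt (real n) * partial_sum n \<omega> - 1 / sqrt (real n) * MD.T n \<omega>) \<le> e"
    if n: "max 1 n0 \<le> n" for n
  proof (rule power2_le_imp_le)
    have n': "0 < real n" "6 * real N * total\<^sup>2 / e\<^sup>2 < real n" using n n0 by linarith+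
    have "l2_norm M (\<lambda>\<omega>. 1 / sqrt (real n) * partial_sum n \<omega> - 1 / sqrt (real n) * MD.T n \<omega>)
        = \<bar>1 / sqrt (real n)\<bar> * l2_norm M (remainder N n)"
      unfolding l2_norm_cmult[symmetric] by (simp add: remainder_def right_diff_distrib diff_divide_distrib)
    then have "(l2_norm M (\<lambda>\<omega>. 1 / sqrt (real n) * partial_sum n \<omega> - 1 / sqrt (real n) * MD.T n \<omega>))\<^sup>2
        = (l2_norm M (remainder N n))\<^sup>2 / real n"
      by (simp add: power_mult_distrib power_divide)
    also have "\<dots> \<le> (real n * (d\<^sup>2 + d * total) + 3 * real N * total\<^sup>2) / real n"
      using d(1) n' by (intro divide_right_mono remainder_second_moment_le tail) auto
    also have "\<dots> = (d\<^sup>2 + d * total) + 3 * real N * total\<^sup>2 / real n"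
      using n' by (simp add: add_divide_distrib)
    also have "\<dots> \<le> e\<^sup>2 / 2 + e\<^sup>2 / 2"
      using dA n' e by (intro add_mono) (auto simp: field_simps)
    finally show "(l2_norm M (\<lambda>\<omega>. 1 / sqrt (real n) * partial_sum n \<omega> - 1 / sqrt (real n) * MD.T n \<omega>))\<^sup>2 \<le> e\<^sup>2"
      by simp
  qed (use e in simp)
  show "\<exists>T v. 0 \<le> v \<and> (\<forall>n. square_integrable M (T n)) \<and>
      (\<forall>\<^sub>F n in sequentially. l2_norm M (\<lambda>\<omega>. 1 / sqrt (real n) * partial_sum n \<omega> - T n \<omega>) \<le> e) \<and>
      (\<forall>u. (\<lambda>n. char (distr M borel (T n)) u) \<longlonglongrightarrow> exp (- (v * u\<^sup>2 / 2)))"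
  proof (intro exI conjI allI)
    show "0 \<le> MD.\<sigma>2" by (rule MD.\<sigma>2_nonneg)
    show "square_integrable M (\<lambda>\<omega>. 1 / sqrt (real n) * MD.T n \<omega>)" for n
      by (intro square_integrable_cmult MD.T_square_integrable)
    show "\<forall>\<^sub>F n in sequentially. l2_norm M (\<lambda>\<omega>. 1 / sqrt (real n) * partial_sum n \<omega> - 1 / sqrt (real n) * MD.T n \<omega>) \<le> e"
      using close by (rule eventually_sequentiallyI)
    show "(\<lambda>n. char (distr M borel (\<lambda>\<omega>. 1 / sqrt (real n) * MD.T n \<omega>)) u) \<longlonglongrightarrow> exp (- (MD.\<sigma>2 * u\<^sup>2 / 2))" for u
      by (rule MD.martingale_difference_clt)
  qed
qed

end

section \<open>The weighted double sum\<close>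

lemma same_fdd_single:
  assumes "same_fdd M N X X'" and X: "X i \<in> M \<rightarrow>\<^sub>M N" "X' i \<in> M \<rightarrow>\<^sub>M N"
  shows "distr M N (X i) = distr M N (X' i)"
proof -
  have "distr M N f = distr (distr M (PiM {i} (\<lambda>_. N)) (\<lambda>\<omega>. \<lambda>k\<in>{i}. f \<omega>)) N (\<lambda>x. x i)"
    if f: "f \<in> M \<rightarrow>\<^sub>M N" for f
  proof -
    have "(\<lambda>\<omega>. \<lambda>k\<in>{i}. f \<omega>) \<in> M \<rightarrow>\<^sub>M PiM {i} (\<lambda>_. N)" by (rule measurable_restrict) (rule f)
    moreover have "(\<lambda>x. x i) \<in> PiM {i} (\<lambda>_. N) \<rightarrow>\<^sub>M N" by (rule measurable_component_singleton) simp
    ultimately show ?thesis by (simp add: distr_distr comp_def)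
  qed
  note this[OF X(1)] this[OF X(2)]
  moreover have r: "(\<lambda>\<omega>. \<lambda>k\<in>{i}. Z k \<omega>) = (\<lambda>\<omega>. \<lambda>k\<in>{i}. Z i \<omega>)" for Z :: "_ \<Rightarrow> _ \<Rightarrow> 'b"
    by (auto simp: fun_eq_iff)
  moreover have "distr M (PiM {i} (\<lambda>_. N)) (\<lambda>\<omega>. \<lambda>k\<in>{i}. X k \<omega>) = distr M (PiM {i} (\<lambda>_. N)) (\<lambda>\<omega>. \<lambda>k\<in>{i}. X' k \<omega>)"
    using assms(1) unfolding same_fdd_def by blast
  ultimately show ?thesis unfolding r[of X] r[of X'] by simp
qed

lemma jointly_stationary_law:
  assumes st: "jointly_stationary M S \<epsilon> Y"
    and Y: "\<And>i j. Y i j \<in> borel_measurable M" and past: "\<And>k. past \<epsilon> k \<in> M \<rightarrow>\<^sub>M past_space S"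
  shows "distr M (borel \<Otimes>\<^sub>M past_space S) (\<lambda>\<omega>. (Y (i + t) (j + t) \<omega>, past \<epsilon> (k + t) \<omega>)) =
    distr M (borel \<Otimes>\<^sub>M past_space S) (\<lambda>\<omega>. (Y i j \<omega>, past \<epsilon> k \<omega>))"
  using same_fdd_single[OF spec[OF st[unfolded jointly_stationary_def], of t], of "(i, j, k)"] Y past
  by simp

text \<open>
  Since \<open>\<alpha>\<close> is symmetric, a sum over the plane is at most twice the sum over \<open>b \<le> a\<close>. There it
  vanishes for \<open>a < 0\<close>, and \<open>i = a\<close>, \<open>k = a - b\<close> turns the rest into the given double series.
\<close>

lemma summable_on_half_plane:
  fixes \<alpha> :: "int \<Rightarrow> int \<Rightarrow> real"
  assumes nonneg: "\<And>a b. 0 \<le> \<alpha> a b" and sym: "\<And>a b. \<alpha> a b = \<alpha> b a"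
    and neg: "\<And>a b. b \<le> a \<Longrightarrow> a < 0 \<Longrightarrow> \<alpha> a b = 0"
    and fin: "(\<Sum>k. \<Sum>i. ennreal (\<alpha> (int i) (int i - int k))) < \<infinity>"
  shows "(\<lambda>(a, b). \<alpha> a b) summable_on UNIV"
proof (rule nonneg_bdd_above_summable_on)
  define C where "C = enn2real (\<Sum>k. \<Sum>i. ennreal (\<alpha> (int i) (int i - int k)))"
  have C: "0 \<le> C" "(\<Sum>k. \<Sum>i. ennreal (\<alpha> (int i) (int i - int k))) = ennreal C"
    using fin by (simp_all add: C_def)
  define f where "f = (\<lambda>(a, b). \<alpha> a b)"
  have f0: "0 \<le> f x" for x by (simp add: f_def nonneg split: prod.split)
  have half: "sum f K \<le> C" if K: "finite K" "\<And>a b. (a, b) \<in> K \<Longrightarrow> b \<le> a" for K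
  proof -
    define K' where "K' = {x\<in>K. 0 \<le> fst x}"
    define \<pi> where "\<pi> x = (nat (fst x - snd x), nat (fst x))" for x :: "int \<times> int"
    have "finite (\<pi> ` K')" using K by (simp add: K'_def)
    then obtain n where n: "\<pi> ` K' \<subseteq> {..<n} \<times> {..<n}"
    proof -
      have "finite (fst ` \<pi> ` K' \<union> snd ` \<pi> ` K')" using \<open>finite (\<pi> ` K')\<close> by simp
      then obtain n where "fst ` \<pi> ` K' \<union> snd ` \<pi> ` K' \<subseteq> {..<n}" using finite_nat_bounded by blast
      then have "y \<in> {..<n} \<times> {..<n}" if "y \<in> \<pi> ` K'" for y
        using imageI[OF that, of fst] imageI[OF that, of snd] by (auto simp only: mem_Times_iff)
      then have "\<pi> ` K' \<subseteq> {..<n} \<times> {..<n}" by (rule subsetI)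
      then show ?thesis by (rule that)
    qed
    have inj: "inj_on \<pi> K'"
    proof (rule inj_onI)
      fix x y assume xy: "x \<in> K'" "y \<in> K'" "\<pi> x = \<pi> y"
      then have "snd x \<le> fst x" "snd y \<le> fst y" "0 \<le> fst x" "0 \<le> fst y"
        using K(2)[of "fst x" "snd x"] K(2)[of "fst y" "snd y"] by (auto simp: K'_def)
      with xy(3) show "x = y" by (auto simp: \<pi>_def prod_eq_iff nat_eq_iff2)
    qed
    have "f x = 0" if "x \<in> K - K'" for x
      using that K(2)[of "fst x" "snd x"] neg[of "snd x" "fst x"] by (auto simp: K'_def f_def split_def not_le)
    then have "sum f K = sum f K'"
      using K(1) by (intro sum.mono_neutral_right) (auto simp: K'_def)
    also have "\<dots> = (\<Sum>x\<in>K'. \<alpha> (int (snd (\<pi> x))) (int (snd (\<pi> x)) - int (fst (\<pi> x))))"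
    proof (rule sum.cong[OF refl])
      fix x assume x: "x \<in> K'"
      then have "snd x \<le> fst x" "0 \<le> fst x" using K(2)[of "fst x" "snd x"] by (auto simp: K'_def)
      then show "f x = \<alpha> (int (snd (\<pi> x))) (int (snd (\<pi> x)) - int (fst (\<pi> x)))"
        by (simp add: f_def \<pi>_def split_def)
    qed
    also have "\<dots> = (\<Sum>y\<in>\<pi> ` K'. \<alpha> (int (snd y)) (int (snd y) - int (fst y)))"
      by (simp add: sum.reindex[OF inj])
    also have "\<dots> \<le> (\<Sum>y\<in>{..<n} \<times> {..<n}. \<alpha> (int (snd y)) (int (snd y) - int (fst y)))"
      using n nonneg by (intro sum_mono2) auto
    also have "\<dots> = (\<Sum>k<n. \<Sum>i<n. \<alpha> (int i) (int i - int k))"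
      by (simp add: sum.cartesian_product split_def)
    also have "\<dots> \<le> C"
    proof -
      have "ennreal (\<Sum>k<n. \<Sum>i<n. \<alpha> (int i) (int i - int k)) = (\<Sum>k<n. \<Sum>i<n. ennreal (\<alpha> (int i) (int i - int k)))"
        using nonneg by (simp add: sum_nonneg flip: sum_ennreal)
      also have "\<dots> \<le> (\<Sum>k<n. \<Sum>i. ennreal (\<alpha> (int i) (int i - int k)))"
        by (intro sum_mono sum_le_suminf) auto
      also have "\<dots> \<le> (\<Sum>k. \<Sum>i. ennreal (\<alpha> (int i) (int i - int k)))"
        by (intro sum_le_suminf) auto
      finally show ?thesis using C by (simp add: ennreal_le_iff)
    qed
    finally show ?thesis .
  qed
  have "sum f K \<le> 2 * C" if K: "finite K" for K
  proof -
    define K1 K2 where "K1 = {x\<in>K. snd x \<le> fst x}" and "K2 = {x\<in>K. fst x < snd x}"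
    have "K = K1 \<union> K2" "K1 \<inter> K2 = {}" "finite K1" "finite K2" using K by (auto simp: K1_def K2_def)
    then have "sum f K = sum f K1 + sum f K2" by (metis sum.union_disjoint)
    also have "sum f K2 = sum f (prod.swap ` K2)"
      by (subst sum.reindex) (auto simp: f_def sym split_def intro!: sum.cong)
    also have "sum f K1 + sum f (prod.swap ` K2) \<le> C + C"
      using K by (intro add_mono half) (auto simp: K1_def K2_def)
    finally show ?thesis by simp
  qed
  then show "bdd_above (sum (\<lambda>(a, b). \<alpha> a b) ` {F. F \<subseteq> UNIV \<and> finite F})"
    unfolding f_def[symmetric] by (intro bdd_aboveI[of _ "2 * C"]) auto
qed (use nonneg in auto)

theorem theorem1:
  fixes M :: "'a measure" and S :: "'s measure"
    and \<epsilon> :: "int \<Rightarrow> 'a \<Rightarrow> 's"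
    and Y :: "int \<Rightarrow> int \<Rightarrow> 'a \<Rightarrow> real"
    and w :: "int \<Rightarrow> real"
  assumes "prob_space M"
    and "iid M S \<epsilon>"
    and "\<And>i j. Y i j \<in> borel_measurable (past_algebra M S \<epsilon> (max i j))"
    and "\<And>i j. integrable M (\<lambda>\<omega>. (Y i j \<omega>)\<^sup>2)"
    and "\<And>i j. integral\<^sup>L M (Y i j) = 0"
    and "\<And>i j. AE \<omega> in M. Y i j \<omega> = Y j i \<omega>"
    and "jointly_stationary M S \<epsilon> Y"
    and "\<And>i. w (- i) = w i"
    and "(\<Sum>k. \<Sum>i. ennreal (\<bar>w (int k)\<bar> * theta M S \<epsilon> Y (int i) (int i - int k))) < \<infinity>"
  shows "\<exists>\<sigma>2\<ge>0. weak_conv_m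
           (\<lambda>n. distr M borel
              (\<lambda>\<omega>. 1 / sqrt (real n) *
                 (\<Sum>i\<in>{1..int n}. \<Sum>j\<in>{1..int n}. w (i - j) * Y i j \<omega>)))
           (normal_law 0 \<sigma>2)"
proof -
  interpret prob_space M by fact
  have ind: "indep_vars (\<lambda>_. S) \<epsilon> UNIV" using assms(2) by (simp add: iid_def)
  then have [measurable]: "\<epsilon> i \<in> M \<rightarrow>\<^sub>M S" for i by (simp add: indep_vars_def)
  have past[measurable]: "past \<epsilon> t \<in> M \<rightarrow>\<^sub>M past_space S" for t
    unfolding past_def past_space_def
    by (rule measurable_PiM_single') (auto intro: measurable_space[of "\<epsilon> _" M S])
  have "subalgebra M (past_algebra M S \<epsilon> t)" for t
    unfolding subalgebra_def past_algebra_def using measurable_sets[OF past] measurable_space[OF past]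
    by (auto simp: sets_vimage_algebra2)
  then have Ym[measurable]: "Y i j \<in> borel_measurable M" for i j
    using measurable_from_subalg assms(3) by blast
  note law = jointly_stationary_law[OF assms(7) Ym past]
  interpret past_process M S \<epsilon>
  proof
    show "indep_vars (\<lambda>_. S) \<epsilon> UNIV" by fact
    show "distr M (past_space S) (past \<epsilon> t) = distr M (past_space S) (past \<epsilon> 0)" for t
    proof -
      have "distr M (past_space S) (past \<epsilon> k) =
          distr (distr M (borel \<Otimes>\<^sub>M past_space S) (\<lambda>\<omega>. (Y i j \<omega>, past \<epsilon> k \<omega>))) (past_space S) snd" for i j k
        by (simp add: distr_distr comp_def)
      from this[of "0 + t" "0 + t" "0 + t"] this[of 0 0 0] law[of 0 t 0 0] show ?thesis by simp
    qed
  qed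
  define X where "X i j \<omega> = w (i - j) * Y i j \<omega>" for i j \<omega>
  have Ysq: "square_integrable M (Y i j)" for i j
    using assms(4) by (simp add: square_integrable_def)
  have X_norm: "l2_norm M (P 0 (X i j)) = \<bar>w (i - j)\<bar> * theta M S \<epsilon> Y i j" for i j
  proof -
    have "l2_norm M (P 0 (X i j)) = l2_norm M (\<lambda>\<omega>. w (i - j) * P 0 (Y i j) \<omega>)"
      using P_cmult[OF Ysq, of 0 "w (i - j)" i j] square_integrable_P[OF square_integrable_cmult[OF Ysq], of 0 "w (i - j)" i j]
        square_integrable_P[OF Ysq, of 0 i j]
      by (intro l2_norm_cong_AE) (auto simp: X_def[abs_def] square_integrable_def)
    then show ?thesis by (simp add: l2_norm_cmult theta_def)
  qed
  have theta_sym: "theta M S \<epsilon> Y i j = theta M S \<epsilon> Y j i" for i j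
    unfolding theta_def
  proof (rule l2_norm_cong_AE)
    show "AE \<omega> in M. P 0 (Y i j) \<omega> = P 0 (Y j i) \<omega>"
      using cond.real_cond_exp_cong[OF assms(6)[of i j] Ym Ym, of 0]
        cond.real_cond_exp_cong[OF assms(6)[of i j] Ym Ym, of "0 - 1"]
      by eventually_elim (simp add: projection_def)
  qed (use square_integrable_P[OF Ysq] in \<open>auto simp: square_integrable_def\<close>)
  have theta_neg: "theta M S \<epsilon> Y i j = 0" if "j \<le> i" "i < 0" for i j
  proof -
    have "Y i j \<in> borel_measurable (F i)" using assms(3)[of i j] that by simp
    from P_eq_0_of_measurable[OF this that(2) Ysq]
    have "l2_norm M (P 0 (Y i j)) = l2_norm M (\<lambda>_. 0)"
      using square_integrable_P[OF Ysq, of 0 i j] by (intro l2_norm_cong_AE) (auto simp: square_integrable_def)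
    then show ?thesis by (simp add: theta_def l2_norm_const)
  qed
  interpret stationary_array M S \<epsilon> X
  proof
    fix i j k t :: int
    show "X i j \<in> borel_measurable (F (max i j))"
      unfolding X_def[abs_def] by (intro borel_measurable_times assms(3)) simp
    show "square_integrable M (X i j)"
      unfolding X_def[abs_def] by (intro square_integrable_cmult Ysq)
    show "(\<integral>\<omega>. X i j \<omega> \<partial>M) = 0" by (simp add: X_def assms(5))
    have *: "joint_law (X a b) c = distr (joint_law (Y a b) c) (borel \<Otimes>\<^sub>M past_space S) (\<lambda>(y, z). (w (a - b) * y, z))" for a b c
      by (simp add: distr_distr comp_def X_def[abs_def])
    show "joint_law (X (i + t) (j + t)) (k + t) = joint_law (X i j) k"
      unfolding * law by simp
    have "(\<lambda>(a, b). \<bar>w (a - b)\<bar> * theta M S \<epsilon> Y a b) summable_on UNIV"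
    proof (rule summable_on_half_plane)
      fix a b :: int
      show "0 \<le> \<bar>w (a - b)\<bar> * theta M S \<epsilon> Y a b" by (simp add: theta_def)
      show "\<bar>w (a - b)\<bar> * theta M S \<epsilon> Y a b = \<bar>w (b - a)\<bar> * theta M S \<epsilon> Y b a"
        using assms(8)[of "a - b"] theta_sym[of a b] by simp
      show "b \<le> a \<Longrightarrow> a < 0 \<Longrightarrow> \<bar>w (a - b)\<bar> * theta M S \<epsilon> Y a b = 0"
        by (simp add: theta_neg)
    qed (use assms(9) in simp)
    then show "(\<lambda>(i, j). l2_norm M (P 0 (X i j))) summable_on UNIV" by (simp add: X_norm)
  qed
  have "(\<Sum>i\<in>{1..int n}. \<Sum>j\<in>{1..int n}. w (i - j) * Y i j \<omega>) = partial_sum n \<omega>" for n \<omega>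
    by (simp add: partial_sum_def X_def sum.cartesian_product split_def)
  then show ?thesis using partial_sum_clt by simp
qed

end
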